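(* Let $n\ge2$, $1\le k\le n-1$, $\alpha_1,\alpha_2\in\mathbb{R}$ with $\alpha_2>0$, and $p=1+\alpha_2$. For $\gamma_1,\gamma_2\in\mathbb{R}$ consider $$\|\sin^{\gamma_1}d(0,\cdot)\cos^{\gamma_2}d(0,\cdot)\,R_kf\|_{L^\infty(\Xi_k(\mathbb{S}^n))}\le C\|f\|_{L^{p,1}_{\alpha_1,\alpha_2}(\mathbb{S}^n)}\quad\text{for all even radial }f\in L^{p,1}_{\alpha_1,\alpha_2}(\mathbb{S}^n).\qquad( * )$$ (A) If $k\ge2$, $( * )$ holds if and only if $\gamma_1\ge\max\{0,\frac{\alpha_1+n}{p}-k\}$ and $\gamma_2\ge1$. (B) If $k=1$, $( * )$ holds if and only if these conditions hold and $p\ge2$.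
   Context: $\mathbb{S}^n\subset\mathbb{R}^{n+1}$ unit sphere with origin $0:=e_{n+1}$, distance $d$, surface measure $dx$. $\Xi_k(\mathbb{S}^n)$: $k$-dimensional totally geodesic submanifolds (intersections with $(k+1)$-dimensional linear subspaces) with $d(0,\xi)<\pi/2$, with rotation-invariant measure ($L^\infty$ = essential supremum). $R_kf(\xi)=\int_\xi f\,d_\xi x$. $L^{p,1}_{\alpha_1,\alpha_2}(\mathbb{S}^n)$ is the Lorentz space $L^{p,1}(\mathbb{S}^n,\mu)$ for $d\mu=\sin^{\alpha_1}d(0,x)|\cos d(0,x)|^{\alpha_2}dx$, with norm $p\int_0^\infty\mu(\{|f|>s\})^{1/p}ds$. Even radial: $f(x)=F(|x_{n+1}|)$. $C$ independent of $f$. *)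

theory Defs
  imports "HOL-Analysis.Analysis"
begin

text \<open>Surface measure on the unit sphere of a Euclidean space of dimension d,
  defined via the cone construction: sigma(A) = d * Leb({t x : x in A, 0 < t < 1}),
  i.e. the push-forward of d times Lebesgue measure on the punctured unit ball
  under x maps to x / |x|.\<close>
definition sphere_measure :: "'a::euclidean_space measure" where
  "sphere_measure = scale_measure (of_nat DIM('a))
     (distr (restrict_space lborel (ball 0 1 - {0})) borel (\<lambda>x. x /\<^sub>R norm x))"

definition sph_dist :: "'a::real_inner \<Rightarrow> 'a \<Rightarrow> real" where
  "sph_dist x y = arccos (x \<bullet> y)"

definition great_sphere :: "'a::real_normed_vector set \<Rightarrow> 'a set" where
  "great_sphere V = V \<inter> sphere 0 1"

definition dist_origin :: "'a::real_inner \<Rightarrow> 'a set \<Rightarrow> real" where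
  "dist_origin e V = Inf ((\<lambda>x. sph_dist e x) ` great_sphere V)"

text \<open>Xi_k: k-dimensional totally geodesic submanifolds (given by (k+1)-dimensional
  linear subspaces V) with d(o, xi) < pi/2.\<close>
definition Xi :: "'a::euclidean_space \<Rightarrow> nat \<Rightarrow> 'a set \<Rightarrow> bool" where
  "Xi e k V \<longleftrightarrow> subspace V \<and> dim V = k + 1 \<and> dist_origin e V < pi / 2"

definition onframe :: "real^'m^'k \<Rightarrow> (real^'m) set \<Rightarrow> bool" where
  "onframe u V \<longleftrightarrow> (\<forall>i j. u $ i \<bullet> u $ j = (if i = j then 1 else 0))
      \<and> span (range (\<lambda>j. u $ j)) = V"

text \<open>The totally geodesic Radon transform R_k f(xi) = integral of f over xi = great_sphere V
  w.r.t. its surface measure, with CARD('k) = k + 1: the surface measure of xi is the image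
  of the surface measure of S^k under the isometry c maps to sum_j c_j u_j, u an orthonormal
  frame of V.\<close>
definition radon_param :: "'k::finite itself \<Rightarrow> (real^'m) set \<Rightarrow> real^'k \<Rightarrow> real^'m" where
  "radon_param K V = (let u = (SOME u :: real^'m^'k. onframe u V) in
      (\<lambda>c. \<Sum>j\<in>UNIV. c $ j *\<^sub>R u $ j))"

definition radon :: "'k::finite itself \<Rightarrow> (real^'m \<Rightarrow> real) \<Rightarrow> (real^'m) set \<Rightarrow> real" where
  "radon K f V = (\<integral>c. f (radon_param K V c) \<partial>(sphere_measure :: (real^'k) measure))"

definition radon_integrable :: "'k::finite itself \<Rightarrow> (real^'m \<Rightarrow> real) \<Rightarrow> (real^'m) set \<Rightarrow> bool" where
  "radon_integrable K f V \<longleftrightarrow>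
     integrable (sphere_measure :: (real^'k) measure) (\<lambda>c. f (radon_param K V c))"

definition weighted_sphere :: "'a::euclidean_space \<Rightarrow> real \<Rightarrow> real \<Rightarrow> 'a measure" where
  "weighted_sphere e a1 a2 = density sphere_measure
     (\<lambda>x. ennreal (sin (sph_dist e x) powr a1 * \<bar>cos (sph_dist e x)\<bar> powr a2))"

definition epowr :: "ennreal \<Rightarrow> real \<Rightarrow> ennreal" where
  "epowr x a = (if x = \<infinity> then \<infinity> else ennreal (enn2real x powr a))"

definition lorentz_norm :: "real \<Rightarrow> 'a measure \<Rightarrow> ('a \<Rightarrow> real) \<Rightarrow> ennreal" where
  "lorentz_norm p M f = ennreal p *
     (\<integral>\<^sup>+ s. indicator {0<..} s * epowr (emeasure M {x \<in> space M. \<bar>f x\<bar> > s}) (1 / p) \<partial>lborel)"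

text \<open>The estimate (*): for some constant C, for every even radial f = F(|x_{n+1}|) in
  L^{p,1}_{a1,a2}, p = 1 + a2, the function sin^g1 d(o,.) cos^g2 d(o,.) R_k f is defined and
  bounded by C ||f|| for almost every xi in Xi_k. "Almost every" w.r.t. the rotation-invariant
  measure on Xi_k is expressed via (k+1)-tuples of vectors (rows of w) distributed by Lebesgue
  measure, whose span is uniformly distributed on the Grassmannian (same null sets).\<close>
definition radon_Linf_estimate ::
  "'k::finite itself \<Rightarrow> real^'m \<Rightarrow> real \<Rightarrow> real \<Rightarrow> real \<Rightarrow> real \<Rightarrow> bool" where
  "radon_Linf_estimate K e a1 a2 g1 g2 \<longleftrightarrow>
    (\<exists>C::real. \<forall>F::real \<Rightarrow> real. F \<in> borel_measurable borel \<longrightarrow>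
       (let f = (\<lambda>x::real^'m. F \<bar>x \<bullet> e\<bar>) in
        lorentz_norm (1 + a2) (weighted_sphere e a1 a2) f < \<infinity> \<longrightarrow>
        (AE w in (lborel :: (real^'m^'k) measure).
           Xi e (CARD('k) - 1) (span (range (\<lambda>j. w $ j))) \<longrightarrow>
           (let V = span (range (\<lambda>j. w $ j)) in
             radon_integrable K f V \<and>
             \<bar>sin (dist_origin e V) powr g1 * cos (dist_origin e V) powr g2 * radon K f V\<bar>
               \<le> C * enn2real (lorentz_norm (1 + a2) (weighted_sphere e a1 a2) f)))))"

end

theory Submission
  imports Defs
begin

text \<open>Both sides only see the height t = |x_{n+1}|. Under the surface measure of the k-sphere the
  height has density proportional to (1 - t^2)^(k/2 - 1), and a great sphere at distance d from the
  origin is a k-sphere whose heights are scaled by c = cos d. By the layer cake formula the estimate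
  is equivalent to its restriction to indicators of Borel sets E of heights:
  sin^g1 d cos^g2 d m{t. c t in E} <= C nu(E)^(1/p), where m has density (1 - t^2)^(k/2 - 1) and
  nu has density (1 - t^2)^((a1 + n)/2 - 1) t^(p - 1).

  For sufficiency, substituting u = c t and using 1 - u^2 >= max(1 - c^2, 1 - t^2) reduces the claim
  to m(E)^p <= C (integral over E of phi^(p - 1) dm) with phi = t (1 - t^2)^(k/2), which holds
  because m{phi < l} <= C l. For necessity, the test sets are neighbourhoods of 0 (giving g2 >= 1),
  of 1 (giving the lower bounds of g1) and of an interior height (giving p >= 2 for k = 1).\<close>

subsection \<open>Measures on the interval of heights\<close>

text \<open>In the code m is \<open>height_measure k 0\<close> and nu is
  \<open>height_measure (a1 + n) (p - 1)\<close>. The substitution u = c t costs c^p: c^(p - 1) from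
  the weight of nu and one more c from du. So p = 1 + a2 goes with exactly one power of cos d, and
  g2 = 1 is the extreme case. With A = a1 + n, the condition g1 >= A/p - k says that A/2 - 1 <= p
  g1/2 + (k p/2 - 1). The first share of this power of 1 - u^2 is traded for 1 - c^2, the second for
  1 - t^2. Both trades need a nonnegative exponent, hence g1 >= 0 and k p >= 2. The latter is
  automatic for k >= 2 and means p >= 2 for k = 1, so (A) and (B) are handled together. What remains
  of the weight is phi^(p - 1) times the density of m; this is the origin of phi. Two matters of
  null sets shape the rest. Great spheres through the origin (c = 1) are not reached by the set
  estimate and must be shown negligible. Conversely, the hypothesis of the necessity part speaks of
  almost every great sphere only, so a test cannot prescribe c; it prescribes a short interval for
  c, which must be attained on a set of tuples of positive measure.\<close>

definition height_measure :: "real \<Rightarrow> real \<Rightarrow> real measure" where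
  "height_measure A q = density lborel
     (\<lambda>t. ennreal ((1 - t\<^sup>2) powr (A / 2 - 1) * t powr q) * indicator {0<..<1} t)"

lemma sets_height_measure [simp, measurable_cong]: "sets (height_measure A q) = sets borel"
  by (simp add: height_measure_def)

lemma space_height_measure [simp]: "space (height_measure A q) = UNIV"
  by (simp add: height_measure_def)

lemma nn_integral_height_measure:
  assumes [measurable]: "g \<in> borel_measurable borel"
  shows "(\<integral>\<^sup>+t. g t \<partial>height_measure A q) =
    (\<integral>\<^sup>+t. g t * (ennreal ((1 - t\<^sup>2) powr (A / 2 - 1) * t powr q) * indicator {0<..<1} t) \<partial>lborel)"
  unfolding height_measure_def by (subst nn_integral_density) (auto simp: mult.commute)

lemma emeasure_height_measure:
  assumes [measurable]: "E \<in> sets borel"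
  shows "emeasure (height_measure A q) E =
    (\<integral>\<^sup>+t. ennreal ((1 - t\<^sup>2) powr (A / 2 - 1) * t powr q) * indicator (E \<inter> {0<..<1}) t \<partial>lborel)"
  unfolding height_measure_def
  by (subst emeasure_density) (auto intro!: nn_integral_cong simp: indicator_def)

lemma one_minus_square_pos: "0 < t \<Longrightarrow> t < 1 \<Longrightarrow> 0 < 1 - t\<^sup>2" for t :: real
  by (simp add: power_less_one_iff)

text \<open>The factor \<open>2 * t\<close> turns the density into the derivative of
  \<open>- (2 / k) * (1 - t\<^sup>2) powr (k / 2)\<close>. For k < 2 the integrand is unbounded at
  1, hence the version of the fundamental theorem that differentiates in the interior only.\<close>

lemma nn_integral_height_tail:
  fixes k :: real and \<tau> :: real
  assumes k: "k > 0" and \<tau>: "0 \<le> \<tau>" "\<tau> \<le> 1"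
  shows "(\<integral>\<^sup>+t. ennreal (2 * t * (1 - t\<^sup>2) powr (k / 2 - 1)) * indicator {\<tau>..1} t \<partial>lborel)
    = ennreal (2 / k * (1 - \<tau>\<^sup>2) powr (k / 2))"
proof -
  have "((\<lambda>t. 2 * t * (1 - t\<^sup>2) powr (k / 2 - 1)) has_integral
      (- (2 / k) * (1 - 1\<^sup>2) powr (k / 2)) - (- (2 / k) * (1 - \<tau>\<^sup>2) powr (k / 2))) {\<tau>..1}"
  proof (rule fundamental_theorem_of_calculus_interior)
    show "continuous_on {\<tau>..1} (\<lambda>t. - (2 / k) * (1 - t\<^sup>2) powr (k / 2))"
      using \<tau> k by (intro continuous_intros continuous_on_powr') (auto simp: power_le_one)
    fix t assume t: "t \<in> {\<tau><..<1}"
    have "1 - t\<^sup>2 > 0" using t \<tau> by (intro one_minus_square_pos) auto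
    then have "((\<lambda>t. - (2 / k) * (1 - t\<^sup>2) powr (k / 2)) has_real_derivative
        2 * t * (1 - t\<^sup>2) powr (k / 2 - 1)) (at t)"
      using k by (auto intro!: derivative_eq_intros)
    then show "((\<lambda>t. - (2 / k) * (1 - t\<^sup>2) powr (k / 2)) has_vector_derivative
        2 * t * (1 - t\<^sup>2) powr (k / 2 - 1)) (at t)"
      by (rule has_real_derivative_iff_has_vector_derivative[THEN iffD1])
  qed (use \<tau> in auto)
  then have "((\<lambda>t. 2 * t * (1 - t\<^sup>2) powr (k / 2 - 1)) has_integral 2 / k * (1 - \<tau>\<^sup>2) powr (k / 2)) {\<tau>..1}"
    by simp
  from nn_integral_has_integral_lebesgue'[OF _ this] \<tau> show ?thesis
    by auto
qed

text \<open>The function t (1 - t^2)^(k/2) is comparable to the mass of the height measure between t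
  and the nearest endpoint of the unit interval.\<close>
lemma emeasure_height_measure_sublevel:
  fixes k :: real
  assumes k: "k \<ge> 1"
  obtains C :: real where "C > 0"
    "\<And>l. l > 0 \<Longrightarrow> emeasure (height_measure k 0) {t. t * (1 - t\<^sup>2) powr (k / 2) < l} \<le> ennreal (C * l)"
proof
  define \<kappa> where "\<kappa> = (4 / 3 :: real) powr (k / 2)"
  have \<kappa>: "\<kappa> > 0" by (simp add: \<kappa>_def)
  show "2 * \<kappa> + 4 > 0" using \<kappa> by simp
  fix l :: real assume l: "l > 0"
  define \<phi> where "\<phi> t = t * (1 - t\<^sup>2) powr (k / 2)" for t :: real
  have [measurable]: "\<phi> \<in> borel_measurable borel" unfolding \<phi>_def[abs_def] by measurable
  \<comment> \<open>If t > 1/2, then \<phi> t < l forces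
    \<open>(1 - t\<^sup>2) powr (k / 2) < 2 * l\<close>, that is 1 - t^2 <= r and t >= \<tau>. If t
    <= 1/2, then \<phi> t is at least t (3/4)^(k/2), which forces t <= \<kappa> l. The minimum with
    1 keeps \<tau> in the unit interval.\<close>
  define r where "r = min 1 ((2 * l) powr (2 / k))"
  have r: "0 < r" "r \<le> 1" using l by (auto simp: r_def)
  define \<tau> where "\<tau> = sqrt (1 - r)"
  have \<tau>: "0 \<le> \<tau>" "\<tau> \<le> 1" "1 - \<tau>\<^sup>2 = r" using r by (auto simp: \<tau>_def)
  have "r powr (k / 2) \<le> ((2 * l) powr (2 / k)) powr (k / 2)"
    using r k by (intro powr_mono2) (auto simp: r_def)
  also have "\<dots> = 2 * l" using k l by (simp add: powr_powr)
  finally have rl: "r powr (k / 2) \<le> 2 * l" .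
  have "emeasure (height_measure k 0) {t. \<phi> t < l} =
    (\<integral>\<^sup>+t. ennreal ((1 - t\<^sup>2) powr (k / 2 - 1) * t powr 0) * indicator ({t. \<phi> t < l} \<inter> {0<..<1}) t \<partial>lborel)"
    by (rule emeasure_height_measure) measurable
  also have "\<dots> \<le> (\<integral>\<^sup>+t. 2 * indicator {0..\<kappa> * l} t + ennreal (2 * t * (1 - t\<^sup>2) powr (k / 2 - 1)) * indicator {\<tau>..1} t \<partial>lborel)"
  proof (rule nn_integral_mono)
    fix t :: real
    show "ennreal ((1 - t\<^sup>2) powr (k / 2 - 1) * t powr 0) * indicator ({t. \<phi> t < l} \<inter> {0<..<1}) t \<le>
      2 * indicator {0..\<kappa> * l} t + ennreal (2 * t * (1 - t\<^sup>2) powr (k / 2 - 1)) * indicator {\<tau>..1} t"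
    proof (cases "0 < t \<and> t < 1 \<and> \<phi> t < l")
      case True
      then have t: "0 < t" "t < 1" "\<phi> t < l" by auto
      note p = one_minus_square_pos[OF t(1,2)]
      show ?thesis
      proof (cases "t \<le> 1 / 2")
        case half: True
        have "t\<^sup>2 \<le> (1/2)\<^sup>2" using t half by (intro power_mono) auto
        then have q: "1 - t\<^sup>2 \<ge> 3 / 4" by (simp add: power2_eq_square)
        have w: "(1 - t\<^sup>2) powr (k / 2 - 1) \<le> 2"
        proof -
          have "(1 - t\<^sup>2) powr (k / 2 - 1) \<le> (1 - t\<^sup>2) powr (- 1)"
            using p t k by (intro powr_mono') auto
          also have "\<dots> = 1 / (1 - t\<^sup>2)" using p by (simp add: powr_minus divide_inverse)
          also have "\<dots> \<le> 1 / (3 / 4)" using q by (intro divide_left_mono) auto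
          finally show ?thesis by simp
        qed
        have "t * (3 / 4) powr (k / 2) \<le> \<phi> t"
          unfolding \<phi>_def using t q k by (intro mult_left_mono powr_mono2) auto
        then have "t * (3 / 4) powr (k / 2) * \<kappa> \<le> l * \<kappa>" using t \<kappa> by (intro mult_right_mono) auto
        moreover have "(3 / 4) powr (k / 2) * \<kappa> = 1"
          unfolding \<kappa>_def by (subst powr_mult[symmetric]) auto
        ultimately have "t * 1 \<le> l * \<kappa>" by (metis mult.assoc)
        then have "t \<in> {0..\<kappa> * l}" using t by (simp add: mult.commute)
        moreover have "ennreal ((1 - t\<^sup>2) powr (k / 2 - 1)) \<le> 2"
          using ennreal_leI[OF w] by simp
        ultimately show ?thesis using t by (auto simp: indicator_def intro: order_trans)
      next
        case half: False
        have "(1/2) * (1 - t\<^sup>2) powr (k / 2) \<le> \<phi> t"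
          unfolding \<phi>_def using half by (intro mult_right_mono) auto
        then have "(1 - t\<^sup>2) powr (k / 2) < 2 * l" using t by linarith
        then have "((1 - t\<^sup>2) powr (k / 2)) powr (2 / k) \<le> (2 * l) powr (2 / k)"
          using k by (intro powr_mono2) auto
        then have "1 - t\<^sup>2 \<le> (2 * l) powr (2 / k)" using k p by (simp add: powr_powr)
        then have "1 - t\<^sup>2 \<le> r" using t by (simp add: r_def)
        then have "\<tau>\<^sup>2 \<le> t\<^sup>2" using \<tau> by linarith
        then have "\<tau> \<le> t" using t by (intro power2_le_imp_le[of \<tau> t]) auto
        then have "t \<in> {\<tau>..1}" using t by simp
        \<comment> \<open>Here 2 t > 1, so the factor that makes the tail explicitly integrable can
          be inserted.\<close>
        moreover have "(1 - t\<^sup>2) powr (k / 2 - 1) \<le> 2 * t * (1 - t\<^sup>2) powr (k / 2 - 1)"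
          using half by (simp add: mult_le_cancel_right1)
        ultimately show ?thesis using t
          by (auto simp: indicator_def intro!: add_increasing ennreal_leI)
      qed
    qed (auto simp: indicator_def)
  qed
  also have "\<dots> = 2 * emeasure lborel {0..\<kappa> * l} + ennreal (2 / k * r powr (k / 2))"
    by (subst nn_integral_add) (use nn_integral_height_tail[of k \<tau>] k \<tau> in \<open>auto simp: nn_integral_cmult\<close>)
  also have "\<dots> = ennreal (2 * \<kappa> * l + 2 / k * r powr (k / 2))"
    using \<kappa> l k by (simp add: ennreal_mult'[symmetric] ennreal_numeral[symmetric] mult_ac del: ennreal_numeral)
  also have "\<dots> \<le> ennreal ((2 * \<kappa> + 4) * l)"
  proof (rule ennreal_leI)
    have "2 / k * r powr (k / 2) \<le> 2 * (2 * l)"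
      using k rl l by (intro mult_mono) (auto simp: field_simps)
    then show "2 * \<kappa> * l + 2 / k * r powr (k / 2) \<le> (2 * \<kappa> + 4) * l" by (simp add: algebra_simps)
  qed
  finally show "emeasure (height_measure k 0) {t. t * (1 - t\<^sup>2) powr (k / 2) < l} \<le> ennreal ((2 * \<kappa> + 4) * l)"
    by (simp add: \<phi>_def)
qed

text \<open>At most half of the mass of E lies where \<phi> is below the threshold l chosen in the proof.\<close>
lemma nn_integral_powr_ge_of_sublevel:
  fixes \<phi> :: "'a \<Rightarrow> real"
  assumes [measurable]: "\<phi> \<in> borel_measurable M" "E \<in> sets M"
    and fin: "emeasure M E < \<infinity>" and C: "C > 0"
    and sub: "\<And>l. l > 0 \<Longrightarrow> emeasure M {x \<in> space M. \<phi> x < l} \<le> ennreal (C * l)"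
    and q: "q \<ge> 0"
  shows "ennreal ((1 / (2 * C)) powr q / 2 * measure M E powr (q + 1))
    \<le> (\<integral>\<^sup>+x. ennreal (\<phi> x powr q) * indicator E x \<partial>M)"
proof (cases "measure M E = 0")
  case False
  define \<mu> where "\<mu> = measure M E"
  have \<mu>: "\<mu> > 0" using False by (simp add: \<mu>_def zero_less_measure_iff)
  have em: "emeasure M E = ennreal \<mu>" using fin by (simp add: \<mu>_def emeasure_eq_ennreal_measure less_top)
  \<comment> \<open>With this threshold the sublevel set has mass at most C l = \<mu>/2, so at least
    \<mu>/2 of E remains where \<open>\<phi> x powr q\<close> is at least
    \<open>l powr q\<close>.\<close>
  define l where "l = \<mu> / (2 * C)"
  have l: "l > 0" using \<mu> C by (simp add: l_def)
  define E' where "E' = {x \<in> E. l \<le> \<phi> x}"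
  have EE: "E' = E \<inter> {x \<in> space M. l \<le> \<phi> x}"
    using sets.sets_into_space[OF assms(2)] by (auto simp: E'_def)
  have [measurable]: "E' \<in> sets M" unfolding EE by measurable
  have le: "emeasure M E' \<le> ennreal \<mu>" unfolding em[symmetric] by (rule emeasure_mono) (auto simp: E'_def)
  then have em': "emeasure M E' = ennreal (measure M E')"
    by (intro emeasure_eq_ennreal_measure) (auto simp: top_unique)
  have "ennreal \<mu> \<le> emeasure M (E' \<union> {x \<in> space M. \<phi> x < l})"
    unfolding em[symmetric] using sets.sets_into_space[OF assms(2)]
    by (intro emeasure_mono) (auto simp: E'_def)
  also have "\<dots> \<le> emeasure M E' + emeasure M {x \<in> space M. \<phi> x < l}"
    by (rule emeasure_subadditive) measurable
  also have "\<dots> \<le> ennreal (measure M E') + ennreal (C * l)"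
    using sub[OF l] em' by (intro add_mono) auto
  also have "\<dots> = ennreal (measure M E' + \<mu> / 2)"
    using C \<mu> by (subst ennreal_plus[symmetric]) (auto simp: l_def)
  finally have half: "\<mu> / 2 \<le> measure M E'"
    using \<mu> by (subst (asm) ennreal_le_iff) auto
  have "(1 / (2 * C)) powr q / 2 * \<mu> powr (q + 1) = l powr q * (\<mu> / 2)"
    using \<mu> C by (simp add: l_def powr_add powr_divide powr_mult)
  also have "ennreal \<dots> \<le> ennreal (l powr q) * ennreal (measure M E')"
    using mult_left_mono[OF half, of "l powr q"] by (subst ennreal_mult'[symmetric]) (auto intro!: ennreal_leI)
  also have "\<dots> = (\<integral>\<^sup>+x. ennreal (l powr q) * indicator E' x \<partial>M)"
    by (simp add: nn_integral_cmult em')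
  also have "\<dots> \<le> (\<integral>\<^sup>+x. ennreal (\<phi> x powr q) * indicator E x \<partial>M)"
    using l q by (intro nn_integral_mono) (auto simp: E'_def indicator_def intro!: ennreal_leI powr_mono2)
  finally show ?thesis by (simp add: \<mu>_def)
qed simp

text \<open>On the unit interval t (1 - t^2)^(k/2) is at most 1, so the sublevel estimate at the
  level 2 already covers all the mass.\<close>

lemma emeasure_height_measure_finite:
  fixes k :: real
  assumes "k \<ge> 1"
  shows "emeasure (height_measure k 0) E < \<infinity>"
proof -
  obtain C where C: "\<And>l. l > 0 \<Longrightarrow> emeasure (height_measure k 0) {t. t * (1 - t\<^sup>2) powr (k / 2) < l} \<le> ennreal (C * l)"
    using emeasure_height_measure_sublevel[OF assms] by metis
  have "emeasure (height_measure k 0) E \<le> emeasure (height_measure k 0) UNIV"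
    by (rule emeasure_mono) auto
  also have "\<dots> = emeasure (height_measure k 0) {t. t * (1 - t\<^sup>2) powr (k / 2) < 2}"
  proof -
    have "t * (1 - t\<^sup>2) powr (k / 2) \<le> 1" if "0 < t" "t < 1" for t :: real
      using that one_minus_square_pos[OF that] assms by (intro mult_le_one powr_le1) auto
    then show ?thesis
      by (subst (1 2) emeasure_height_measure) (force intro!: nn_integral_cong simp: indicator_def)+
  qed
  also have "\<dots> < \<infinity>" using C[of 2] by (auto intro: le_less_trans)
  finally show ?thesis .
qed

text \<open>This is the set estimate behind sufficiency, raised to the power p. \<open>K\<close> is
  the constant of \<open>nn_integral_powr_ge_of_sublevel\<close> for the exponent
  \<open>p - 1\<close>; it is fixed before c, \<gamma> and E, and this uniformity is what the
  integration over level sets requires.\<close>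

lemma emeasure_height_measure_scaled_ge:
  fixes k p A :: real
  assumes k: "k \<ge> 1" and p: "p \<ge> 1" and kp: "k * p \<ge> 2"
  obtains K :: real where "K > 0"
    "\<And>c \<gamma> E. \<lbrakk>0 < c; c < 1; \<gamma> \<ge> 0; \<gamma> \<ge> A / p - k; E \<in> sets borel\<rbrakk> \<Longrightarrow>
      ennreal (K * ((1 - c\<^sup>2) powr (\<gamma> / 2) * c * measure (height_measure k 0) {t. c * t \<in> E}) powr p)
        \<le> emeasure (height_measure A (p - 1)) E"
proof -
  obtain C where C: "C > 0" "\<And>l. l > 0 \<Longrightarrow> emeasure (height_measure k 0) {t. t * (1 - t\<^sup>2) powr (k / 2) < l} \<le> ennreal (C * l)"
    using emeasure_height_measure_sublevel[OF k] by metis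
  define K where "K = (1 / (2 * C)) powr (p - 1) / 2"
  have K: "K > 0" using C by (simp add: K_def)
  show thesis
  proof (rule that[OF K])
    fix c \<gamma> :: real and E :: "real set"
    assume c: "0 < c" "c < 1" and \<gamma>: "\<gamma> \<ge> 0" "\<gamma> \<ge> A / p - k" and E[measurable]: "E \<in> sets borel"
    define s where "s = (1 - c\<^sup>2) powr (\<gamma> / 2)"
    define \<mu> where "\<mu> = measure (height_measure k 0) {t. c * t \<in> E}"
    have [measurable]: "{t. c * t \<in> E} \<in> sets borel" by measurable
    note cp = one_minus_square_pos[OF c]
    define w where "w u = ennreal ((1 - u\<^sup>2) powr (A / 2 - 1) * u powr (p - 1))" for u
    have [measurable]: "w \<in> borel_measurable borel" unfolding w_def[abs_def] by measurable
    have main: "ennreal (s powr p * c powr (p - 1)) * (ennreal ((t * (1 - t\<^sup>2) powr (k / 2)) powr (p - 1)) * indicator {t. c * t \<in> E} t *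
       (ennreal ((1 - t\<^sup>2) powr (k / 2 - 1) * t powr 0) * indicator {0<..<1} t)) \<le> w (c * t) * indicator (E \<inter> {0<..<1}) (c * t)" for t
    proof (cases "0 < t \<and> t < 1 \<and> c * t \<in> E")
      case True
      then have t: "0 < t" "t < 1" "c * t \<in> E" by auto
      note tp = one_minus_square_pos[OF t(1,2)]
      define x where "x = 1 - (c * t)\<^sup>2"
      have ct: "0 < c * t" "c * t < 1" using c t mult_strict_mono[of c 1 t 1] by auto
      have "(c * t)\<^sup>2 \<le> c\<^sup>2" using c t by (intro power_mono) (auto simp: mult_le_cancel_left1)
      moreover have "(c * t)\<^sup>2 \<le> t\<^sup>2" using c t by (intro power_mono) (auto simp: mult_le_cancel_right1)
      ultimately have x: "0 < x" "x \<le> 1" "1 - c\<^sup>2 \<le> x" "1 - t\<^sup>2 \<le> x"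
        using one_minus_square_pos[OF ct] by (auto simp: x_def)
      have "s powr p * (1 - t\<^sup>2) powr (k * p / 2 - 1) = (1 - c\<^sup>2) powr (p * \<gamma> / 2) * (1 - t\<^sup>2) powr (k * p / 2 - 1)"
        by (simp add: s_def powr_powr mult.commute)
      also have "\<dots> \<le> x powr (p * \<gamma> / 2) * x powr (k * p / 2 - 1)"
        using x cp tp p \<gamma> kp by (intro mult_mono powr_mono2) auto
      also have "\<dots> = x powr (p * \<gamma> / 2 + (k * p / 2 - 1))" by (simp add: powr_add)
      \<comment> \<open>Since x <= 1, the smaller exponent gives the larger power; the comparison of
        exponents is the lower bound on \<gamma> multiplied by p/2.\<close>
      also have "\<dots> \<le> x powr (A / 2 - 1)"
      proof (rule powr_mono')
        have "A \<le> p * (\<gamma> + k)" using \<gamma>(2) p by (simp add: field_simps)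
        then show "A / 2 - 1 \<le> p * \<gamma> / 2 + (k * p / 2 - 1)" by (simp add: algebra_simps)
      qed (use x in auto)
      finally have le: "s powr p * (1 - t\<^sup>2) powr (k * p / 2 - 1) \<le> x powr (A / 2 - 1)" .
      have "(t * (1 - t\<^sup>2) powr (k / 2)) powr (p - 1) * (1 - t\<^sup>2) powr (k / 2 - 1) =
         t powr (p - 1) * (1 - t\<^sup>2) powr (k / 2 * (p - 1) + (k / 2 - 1))"
        using t tp by (simp add: powr_mult powr_powr powr_add)
      also have "k / 2 * (p - 1) + (k / 2 - 1) = k * p / 2 - 1" by (simp add: field_simps)
      finally have "s powr p * c powr (p - 1) * ((t * (1 - t\<^sup>2) powr (k / 2)) powr (p - 1) * (1 - t\<^sup>2) powr (k / 2 - 1)) =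
        (s powr p * (1 - t\<^sup>2) powr (k * p / 2 - 1)) * (c powr (p - 1) * t powr (p - 1))" by simp
      also have "\<dots> \<le> x powr (A / 2 - 1) * (c * t) powr (p - 1)"
        using le c t by (subst powr_mult) (auto intro!: mult_right_mono)
      finally have fin: "s powr p * c powr (p - 1) * ((t * (1 - t\<^sup>2) powr (k / 2)) powr (p - 1) * (1 - t\<^sup>2) powr (k / 2 - 1)) \<le>
        x powr (A / 2 - 1) * (c * t) powr (p - 1)" .
      show ?thesis
        using t ct ennreal_leI[OF fin] by (simp add: ennreal_mult'[symmetric] w_def x_def)
    qed (auto simp: indicator_def)
    \<comment> \<open>The factor c^p is split into c^(p - 1), to be absorbed by the weight
      \<open>(c * t) powr (p - 1)\<close>, and a single c, kept outside as the Jacobian of u = c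
      t.\<close>
    have "ennreal (K * (s * c * \<mu>) powr p) = ennreal (c * (s powr p * c powr (p - 1))) * ennreal (K * \<mu> powr ((p - 1) + 1))"
      using c K by (subst ennreal_mult'[symmetric]) (auto simp: powr_mult powr_diff s_def \<mu>_def)
    also have "\<dots> \<le> ennreal (c * (s powr p * c powr (p - 1))) *
       (\<integral>\<^sup>+t. ennreal ((t * (1 - t\<^sup>2) powr (k / 2)) powr (p - 1)) * indicator {t. c * t \<in> E} t \<partial>height_measure k 0)"
      unfolding K_def \<mu>_def using C p emeasure_height_measure_finite[OF k]
      by (intro mult_left_mono nn_integral_powr_ge_of_sublevel) auto
    also have "\<dots> = ennreal c * (ennreal (s powr p * c powr (p - 1)) *
       (\<integral>\<^sup>+t. ennreal ((t * (1 - t\<^sup>2) powr (k / 2)) powr (p - 1)) * indicator {t. c * t \<in> E} t \<partial>height_measure k 0))"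
      using c by (simp add: ennreal_mult' mult.assoc)
    also have "\<dots> = ennreal c * (\<integral>\<^sup>+t. ennreal (s powr p * c powr (p - 1)) * (ennreal ((t * (1 - t\<^sup>2) powr (k / 2)) powr (p - 1)) * indicator {t. c * t \<in> E} t *
       (ennreal ((1 - t\<^sup>2) powr (k / 2 - 1) * t powr 0) * indicator {0<..<1} t)) \<partial>lborel)"
      by (subst nn_integral_height_measure, simp, subst nn_integral_cmult) simp_all
    also have "\<dots> \<le> ennreal c * (\<integral>\<^sup>+t. w (c * t) * indicator (E \<inter> {0<..<1}) (c * t) \<partial>lborel)"
      by (intro mult_left_mono nn_integral_mono main) auto
    also have "\<dots> = (\<integral>\<^sup>+u. w u * indicator (E \<inter> {0<..<1}) u \<partial>lborel)"
      using c by (subst (2) nn_integral_real_affine[where c = c and t = 0]) auto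
    also have "\<dots> = emeasure (height_measure A (p - 1)) E"
      by (simp add: emeasure_height_measure w_def)
    finally show "ennreal (K * ((1 - c\<^sup>2) powr (\<gamma> / 2) * c * measure (height_measure k 0) {t. c * t \<in> E}) powr p)
        \<le> emeasure (height_measure A (p - 1)) E" by (simp add: s_def \<mu>_def)
  qed
qed

subsection \<open>Distribution of the height on the sphere\<close>

lemma nn_integral_sphere_measure:
  fixes G :: "'a::euclidean_space \<Rightarrow> ennreal"
  assumes [measurable]: "G \<in> borel_measurable borel"
  shows "(\<integral>\<^sup>+x. G x \<partial>sphere_measure) =
    of_nat DIM('a) * (\<integral>\<^sup>+x. G (x /\<^sub>R norm x) * indicator (ball 0 1 - {0}) x \<partial>lborel)"
proof -
  have [measurable]: "(\<lambda>x::'a. x /\<^sub>R norm x) \<in> borel_measurable (restrict_space lborel (ball 0 1 - {0}))"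
    by (rule measurable_restrict_space1) measurable
  show ?thesis
    unfolding sphere_measure_def
    by (simp add: nn_integral_scale_measure nn_integral_distr nn_integral_restrict_space)
qed

lemma sets_sphere_measure [measurable_cong, simp]: "sets sphere_measure = sets borel"
  by (simp add: sphere_measure_def)

lemma space_sphere_measure [simp]: "space sphere_measure = UNIV"
  by (simp add: sphere_measure_def space_scale_measure)

text \<open>The open ball is the increasing union of the closed balls of radius
  \<open>\<rho> n\<close>, whose volumes \<open>emeasure_cball_aux\<close> supplies. The radii start
  at r/2, so that all of them are positive.\<close>

lemma emeasure_PiM_open_ball:
  assumes "finite A" "A \<noteq> {}" "r > 0"
  shows "emeasure (Pi\<^sub>M A (\<lambda>_. lborel)) {f \<in> space (Pi\<^sub>M A (\<lambda>_. lborel)). sqrt (\<Sum>i\<in>A. (f i)\<^sup>2) < r}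
    = ennreal (unit_ball_vol (real (card A)) * r ^ card A)"
proof -
  let ?M = "Pi\<^sub>M A (\<lambda>_. lborel) :: ('a \<Rightarrow> real) measure"
  define \<rho> where "\<rho> n = r * (1 - 1 / real (Suc (Suc n)))" for n
  define B where "B n = {f. sqrt (\<Sum>i\<in>A. (f i)\<^sup>2) \<le> \<rho> n} \<inter> space ?M" for n
  have pos: "\<rho> n > 0" "\<rho> n < r" for n
    using \<open>r > 0\<close> by (auto simp: \<rho>_def field_simps intro!: add_pos_nonneg)
  have "1 - 1 / real (Suc (Suc m)) \<le> 1 - 1 / real (Suc (Suc n))" if "m \<le> n" for m n
    using that by (simp add: frac_le)
  then have mono: "\<rho> m \<le> \<rho> n" if "m \<le> n" for m n
    using that \<open>r > 0\<close> unfolding \<rho>_def by (intro mult_left_mono) auto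
  have lim: "\<rho> \<longlonglongrightarrow> r"
  proof -
    have "(\<lambda>n. 1 / real (Suc (Suc n))) \<longlonglongrightarrow> 0"
      using LIMSEQ_Suc[OF LIMSEQ_inverse_real_of_nat] by (simp add: field_simps)
    then have "(\<lambda>n. r * (1 - 1 / real (Suc (Suc n)))) \<longlonglongrightarrow> r * (1 - 0)"
      by (intro tendsto_intros)
    then show ?thesis by (simp add: \<rho>_def[abs_def])
  qed
  have "(\<lambda>n. emeasure ?M (B n)) \<longlonglongrightarrow> emeasure ?M (\<Union>n. B n)"
    by (rule Lim_emeasure_incseq) (auto simp: B_def incseq_def intro: order_trans[OF _ mono])
  moreover have "(\<Union>n. B n) = {f \<in> space ?M. sqrt (\<Sum>i\<in>A. (f i)\<^sup>2) < r}"
  proof (intro set_eqI iffI)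
    fix f assume "f \<in> {f \<in> space ?M. sqrt (\<Sum>i\<in>A. (f i)\<^sup>2) < r}"
    moreover then have "eventually (\<lambda>n. sqrt (\<Sum>i\<in>A. (f i)\<^sup>2) < \<rho> n) sequentially"
      using order_tendstoD(1)[OF lim] by auto
    ultimately show "f \<in> (\<Union>n. B n)"
      unfolding eventually_sequentially B_def by (auto intro!: less_imp_le)
  qed (use pos in \<open>auto simp: B_def intro: le_less_trans\<close>)
  moreover have "(\<lambda>n. emeasure ?M (B n)) \<longlonglongrightarrow> ennreal (unit_ball_vol (real (card A)) * r ^ card A)"
    unfolding B_def emeasure_cball_aux[OF \<open>finite A\<close> pos(1)]
    by (intro tendsto_ennrealI tendsto_intros lim)
  ultimately show ?thesis
    using LIMSEQ_unique by metis
qed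

text \<open>Fix the height a of a point of the unit ball and let f be its other coordinates. Its
  direction has height t = a / sqrt (a^2 + |f|^2), and the point is in the ball iff t > a. Now t >
  \<tau> iff f lies in the ball of radius a sqrt (1/\<tau>^2 - 1), so the density on the right is
  minus the derivative in \<tau> of the volume of that ball.\<close>

lemma nn_integral_cone_slice:
  fixes g :: "real \<Rightarrow> ennreal" and a :: real
  assumes [measurable]: "g \<in> borel_measurable borel" and A: "finite A" "A \<noteq> {}" and a: "a > 0"
  shows "(\<integral>\<^sup>+f. g (a / sqrt (a\<^sup>2 + (\<Sum>i\<in>A. (f i)\<^sup>2))) * indicator {..<1} (a\<^sup>2 + (\<Sum>i\<in>A. (f i)\<^sup>2)) \<partial>Pi\<^sub>M A (\<lambda>_. lborel))
    = (\<integral>\<^sup>+t. g t * (ennreal (unit_ball_vol (real (card A)) * real (card A) * a ^ card A *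
          (1 / t\<^sup>2 - 1) powr (real (card A) / 2 - 1) / t ^ 3) * indicator {a<..<1} t) \<partial>lborel)"
proof -
  let ?P = "Pi\<^sub>M A (\<lambda>_. lborel) :: ('a \<Rightarrow> real) measure"
  define N where "N = card A"
  define S where "S f = (\<Sum>i\<in>A. (f i)\<^sup>2)" for f :: "'a \<Rightarrow> real"
  define V where "V = unit_ball_vol (real N)"
  define D where "D t = V * real N * a ^ N * (1 / t\<^sup>2 - 1) powr (real N / 2 - 1) / t ^ 3" for t :: real
  have N: "N > 0" using A by (auto simp: N_def card_gt_0_iff)
  have V: "V > 0" by (auto simp: V_def)
  have S[measurable]: "S \<in> borel_measurable ?P" unfolding S_def[abs_def] by measurable
  have S0: "S f \<ge> 0" for f by (auto simp: S_def sum_nonneg)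
  define M1 where "M1 = distr (density ?P (\<lambda>f. indicator {..<1} (a\<^sup>2 + S f))) borel (\<lambda>f. a / sqrt (a\<^sup>2 + S f))"
  define M2 where "M2 = density lborel (\<lambda>t. ennreal (D t) * indicator {a<..<1} t)"
  have Dm[measurable]: "D \<in> borel_measurable borel" unfolding D_def[abs_def] by measurable
  \<comment> \<open>Agreement with finite values on all upper half-lines suffices to identify two
    Borel measures on the line.\<close>
  have key: "emeasure M1 {x<..} = emeasure M2 {x<..} \<and> emeasure M1 {x<..} < \<infinity>" for x
  proof -
    \<comment> \<open>Merges t > x with t > a, the condition of lying in the unit ball.\<close>
    define \<tau> where "\<tau> = max x a"
    have \<tau>: "\<tau> > 0" "\<tau> \<ge> a" using a by (auto simp: \<tau>_def)
    have iff: "(a\<^sup>2 + S f < 1 \<and> x < a / sqrt (a\<^sup>2 + S f)) \<longleftrightarrow> \<tau> < a / sqrt (a\<^sup>2 + S f)" for f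
    proof -
      have p: "sqrt (a\<^sup>2 + S f) > 0" using a S0[of f] by (simp add: add_pos_nonneg)
      have "a\<^sup>2 + S f < 1 \<longleftrightarrow> sqrt (a\<^sup>2 + S f) < 1" by simp
      also have "\<dots> \<longleftrightarrow> a < a / sqrt (a\<^sup>2 + S f)" using p a by (simp add: field_simps)
      finally show ?thesis by (auto simp: \<tau>_def)
    qed
    have "emeasure M1 {x<..} = (\<integral>\<^sup>+f. indicator {f \<in> space ?P. \<tau> < a / sqrt (a\<^sup>2 + S f)} f \<partial>?P)"
      unfolding M1_def
      by (subst emeasure_distr, simp, simp, subst emeasure_density, simp, simp)
         (rule nn_integral_cong, use iff in \<open>auto simp: indicator_def\<close>)
    also have "\<dots> = emeasure ?P {f \<in> space ?P. \<tau> < a / sqrt (a\<^sup>2 + S f)}"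
      by (rule nn_integral_indicator) measurable
    finally have e1: "emeasure M1 {x<..} = emeasure ?P {f \<in> space ?P. \<tau> < a / sqrt (a\<^sup>2 + S f)}" .
    have e2: "emeasure M2 {x<..} = (\<integral>\<^sup>+t. ennreal (D t) * indicator {\<tau><..<1} t \<partial>lborel)"
      unfolding M2_def by (subst emeasure_density) (auto intro!: nn_integral_cong simp: indicator_def \<tau>_def)
    show ?thesis
    proof (cases "\<tau> < 1")
      case True
      define R where "R = a * sqrt (1 / \<tau>\<^sup>2 - 1)"
      have t2: "1 / \<tau>\<^sup>2 - 1 > 0" using True \<tau> by (simp add: power_less_one_iff field_simps)
      have R: "R > 0" using a t2 by (simp add: R_def)
      have "\<tau> < a / sqrt (a\<^sup>2 + S f) \<longleftrightarrow> sqrt (S f) < R" for f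
      proof -
        have p: "a\<^sup>2 + S f > 0" using a S0[of f] by (simp add: add_pos_nonneg)
        have "\<tau> < a / sqrt (a\<^sup>2 + S f) \<longleftrightarrow> sqrt (a\<^sup>2 + S f) < a / \<tau>"
          using p \<tau> by (simp add: field_simps)
        also have "\<dots> \<longleftrightarrow> a\<^sup>2 + S f < (a / \<tau>)\<^sup>2"
          using a \<tau> by (metis divide_pos_pos less_imp_le real_sqrt_less_iff real_sqrt_unique)
        also have "\<dots> \<longleftrightarrow> S f < R\<^sup>2"
          using t2 by (auto simp: R_def power_mult_distrib field_simps)
        also have "\<dots> \<longleftrightarrow> sqrt (S f) < R"
          using R by (metis less_imp_le real_sqrt_less_iff real_sqrt_unique)
        finally show ?thesis .
      qed
      then have m1: "emeasure M1 {x<..} = ennreal (V * R ^ N)"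
        using emeasure_PiM_open_ball[OF A R] unfolding e1 by (simp add: V_def N_def S_def)
      have "(D has_integral (- V * a ^ N * (1 / 1\<^sup>2 - 1) powr (real N / 2)) - (- V * a ^ N * (1 / \<tau>\<^sup>2 - 1) powr (real N / 2))) {\<tau>..1}"
      proof (rule fundamental_theorem_of_calculus_interior)
        show "continuous_on {\<tau>..1} (\<lambda>t. - V * a ^ N * (1 / t\<^sup>2 - 1) powr (real N / 2))"
          using \<tau> N by (intro continuous_intros continuous_on_powr') (auto simp: power_le_one)
        fix t assume t: "t \<in> {\<tau><..<1}"
        have "1 / t\<^sup>2 - 1 > 0" using t \<tau> by (simp add: power_less_one_iff field_simps)
        then have "((\<lambda>t. - V * a ^ N * (1 / t\<^sup>2 - 1) powr (real N / 2)) has_real_derivative D t) (at t)"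
          unfolding D_def using t \<tau>
          by (auto intro!: derivative_eq_intros simp: field_simps power2_eq_square power3_eq_cube)
        then show "((\<lambda>t. - V * a ^ N * (1 / t\<^sup>2 - 1) powr (real N / 2)) has_vector_derivative D t) (at t)"
          by (rule has_real_derivative_iff_has_vector_derivative[THEN iffD1])
      qed (use True in auto)
      then have "(D has_integral V * a ^ N * (1 / \<tau>\<^sup>2 - 1) powr (real N / 2)) {\<tau>..1}"
        by simp
      moreover have "(1 / \<tau>\<^sup>2 - 1) powr (real N / 2) = sqrt (1 / \<tau>\<^sup>2 - 1) ^ N"
        using t2 by (subst powr_realpow[symmetric]) (auto simp: powr_half_sqrt[symmetric] powr_powr)
      ultimately have hi: "(D has_integral V * R ^ N) {\<tau>..1}"
        by (simp add: R_def power_mult_distrib mult.assoc)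
      have "(\<integral>\<^sup>+t. ennreal (D t) * indicator {\<tau>..1} t \<partial>lborel) = ennreal (V * R ^ N)"
        by (rule nn_integral_has_integral_lebesgue'[OF _ hi]) (use V a \<tau> in \<open>auto simp: D_def\<close>)
      moreover have "(\<integral>\<^sup>+t. ennreal (D t) * indicator {\<tau><..<1} t \<partial>lborel) = (\<integral>\<^sup>+t. ennreal (D t) * indicator {\<tau>..1} t \<partial>lborel)"
      proof (rule nn_integral_cong_AE)
        have "AE t in lborel. t \<notin> {\<tau>, 1}"
          by (intro AE_not_in countable_imp_null_set_lborel) auto
        then show "AE t in lborel. ennreal (D t) * indicator {\<tau><..<1} t = ennreal (D t) * indicator {\<tau>..1} t"
          by eventually_elim (auto simp: indicator_def)
      qed
      ultimately show ?thesis using m1 e2 by simp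
    next
      case False
      have "\<not> \<tau> < a / sqrt (a\<^sup>2 + S f)" for f
      proof -
        have "a \<le> sqrt (a\<^sup>2 + S f)" using S0[of f] a by (simp add: real_le_rsqrt)
        then have "a / sqrt (a\<^sup>2 + S f) \<le> 1" using a by (subst divide_le_eq_1_pos) linarith+
        then show ?thesis using False by linarith
      qed
      then show ?thesis using False unfolding e1 e2 by simp
    qed
  qed
  have "M1 = M2"
    by (rule measure_eqI_lessThan) (simp add: M1_def, simp add: M2_def, use key in blast, use key in blast)
  then have "(\<integral>\<^sup>+t. g t \<partial>M1) = (\<integral>\<^sup>+t. g t \<partial>M2)" by simp
  also have "(\<integral>\<^sup>+t. g t \<partial>M1) = (\<integral>\<^sup>+f. g (a / sqrt (a\<^sup>2 + S f)) * indicator {..<1} (a\<^sup>2 + S f) \<partial>?P)"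
    unfolding M1_def by (subst nn_integral_distr) (auto simp: nn_integral_density mult.commute)
  also have "(\<integral>\<^sup>+t. g t \<partial>M2) = (\<integral>\<^sup>+t. g t * (ennreal (D t) * indicator {a<..<1} t) \<partial>lborel)"
    unfolding M2_def by (subst nn_integral_density) (auto simp: mult_ac)
  finally show ?thesis
    by (simp add: S_def D_def V_def N_def)
qed

lemma nn_integral_abs_power_interval:
  fixes t :: real
  assumes "t > 0"
  shows "(\<integral>\<^sup>+a. ennreal (\<bar>a\<bar> ^ N) * indicator {-t<..<t} a \<partial>lborel) = ennreal (2 * t ^ Suc N / real (Suc N))"
proof -
  have *: "((\<lambda>a. a ^ N) has_integral (t ^ Suc N / real (Suc N) - 0 ^ Suc N / real (Suc N))) {0..t}"
    by (rule fundamental_theorem_of_calculus)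
       (use assms in \<open>auto intro!: derivative_eq_intros simp: has_real_derivative_iff_has_vector_derivative[symmetric] simp del: of_nat_Suc power_Suc\<close>)
  have pos: "(\<integral>\<^sup>+a. ennreal (\<bar>a\<bar> ^ N) * indicator {0..t} a \<partial>lborel) = ennreal (t ^ Suc N / real (Suc N))"
  proof -
    have "(\<integral>\<^sup>+a. ennreal (a ^ N) * indicator {0..t} a \<partial>lborel) = ennreal (t ^ Suc N / real (Suc N))"
      using nn_integral_has_integral_lebesgue'[OF _ *] by auto
    moreover have "(\<integral>\<^sup>+a. ennreal (a ^ N) * indicator {0..t} a \<partial>lborel) = (\<integral>\<^sup>+a. ennreal (\<bar>a\<bar> ^ N) * indicator {0..t} a \<partial>lborel)"
      by (rule nn_integral_cong) (auto simp: indicator_def)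
    ultimately show ?thesis by simp
  qed
  have neg: "(\<integral>\<^sup>+a. ennreal (\<bar>a\<bar> ^ N) * indicator {-t..0} a \<partial>lborel) = (\<integral>\<^sup>+a. ennreal (\<bar>a\<bar> ^ N) * indicator {0..t} a \<partial>lborel)"
    by (subst nn_integral_real_affine[where c = "-1" and t = 0])
       (auto simp: indicator_def intro!: nn_integral_cong)
  have "AE a in lborel. a \<notin> {-t, 0, t}"
    by (intro AE_not_in countable_imp_null_set_lborel) auto
  then have "(\<integral>\<^sup>+a. ennreal (\<bar>a\<bar> ^ N) * indicator {-t<..<t} a \<partial>lborel) =
    (\<integral>\<^sup>+a. ennreal (\<bar>a\<bar> ^ N) * indicator {-t..0} a + ennreal (\<bar>a\<bar> ^ N) * indicator {0..t} a \<partial>lborel)"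
    by (intro nn_integral_cong_AE, elim eventually_mono) (use assms in \<open>auto simp: indicator_def\<close>)
  also have "\<dots> = ennreal (t ^ Suc N / real (Suc N)) + ennreal (t ^ Suc N / real (Suc N))"
    by (subst nn_integral_add) (auto simp only: neg pos, measurable)
  also have "\<dots> = ennreal (2 * t ^ Suc N / real (Suc N))"
    using assms by (subst ennreal_plus[symmetric]) (auto simp del: ennreal_plus)
  finally show ?thesis .
qed

text \<open>\<open>real N * unit_ball_vol (real N)\<close> is the area of the unit sphere of
  dimension N - 1, the equator of the N-sphere whose heights are described; the factor 2 comes from
  folding heights t and -t together.\<close>

definition sphere_const :: "nat \<Rightarrow> real" where
  "sphere_const N = 2 * real N * unit_ball_vol (real N)"

lemma sphere_const_pos: "N > 0 \<Longrightarrow> sphere_const N > 0"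
  by (simp add: sphere_const_def)

text \<open>In the cone construction the coordinate a along b is split off and each slice is pushed
  forward to the height t. After Fubini the slices that reach t are those with |a| < t, and the
  integral of |a|^N over them is 2 t^(N + 1)/(N + 1). The denominator cancels the dimension N + 1 in
  \<open>sphere_measure\<close>.\<close>

lemma nn_integral_sphere_measure_inner_Basis:
  fixes g :: "real \<Rightarrow> ennreal" and b :: "'a::euclidean_space"
  assumes g[measurable]: "g \<in> borel_measurable borel" and b: "b \<in> Basis" and d: "DIM('a) \<ge> 2"
  shows "(\<integral>\<^sup>+x. g \<bar>x \<bullet> b\<bar> \<partial>sphere_measure) =
    ennreal (sphere_const (DIM('a) - 1)) * (\<integral>\<^sup>+t. g t \<partial>height_measure (real (DIM('a) - 1)) 0)"
proof -
  define A :: "'a set" where "A = Basis - {b}"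
  define N where "N = card A"
  define V where "V = unit_ball_vol (real N)"
  have N: "N = DIM('a) - 1" using b by (simp add: A_def N_def)
  have A: "finite A" "A \<noteq> {}" "b \<notin> A" "insert b A = Basis"
    using N d b card_gt_0_iff[of A] by (auto simp: A_def N_def)
  have V: "V > 0" by (simp add: V_def)
  have Npos: "N > 0" using N d by simp
  define S where "S f = (\<Sum>i\<in>A. (f i)\<^sup>2)" for f :: "'a \<Rightarrow> real"
  have S0: "S f \<ge> 0" for f by (auto simp: S_def sum_nonneg)
  have [measurable]: "ball 0 1 - {0} \<in> sets (borel :: ('a) measure)" "ball 0 1 \<in> sets (borel :: ('a) measure)"
    by auto
  define \<Phi> where "\<Phi> x = g (\<bar>x \<bullet> b\<bar> / norm x) * indicator (ball 0 1 - {0}) x" for x :: 'a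
  have [measurable]: "\<Phi> \<in> borel_measurable borel" unfolding \<Phi>_def[abs_def] by measurable
  interpret product_sigma_finite "\<lambda>_::'a. lborel :: real measure" by standard
  define Q where "Q t = (1 / t\<^sup>2 - 1) powr (real N / 2 - 1) / t ^ 3" for t :: real
  have [measurable]: "Q \<in> borel_measurable borel" unfolding Q_def[abs_def] by measurable
  have Q0: "Q t \<ge> 0" if "t > 0" for t using that by (simp add: Q_def)
  have inner: "(\<integral>\<^sup>+f. \<Phi> (\<Sum>i\<in>Basis. (f(b := a)) i *\<^sub>R i) \<partial>Pi\<^sub>M A (\<lambda>_. lborel)) =
     (\<integral>\<^sup>+t. g t * (ennreal (V * real N * \<bar>a\<bar> ^ N * Q t) * indicator {\<bar>a\<bar><..<1} t) \<partial>lborel)" if "a \<noteq> 0" for a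
  proof -
    have "\<Phi> (\<Sum>i\<in>Basis. (f(b := a)) i *\<^sub>R i) =
      g (\<bar>a\<bar> / sqrt (\<bar>a\<bar>\<^sup>2 + (\<Sum>i\<in>A. (f i)\<^sup>2))) * indicator {..<1} (\<bar>a\<bar>\<^sup>2 + (\<Sum>i\<in>A. (f i)\<^sup>2))" for f
    proof -
      define x where "x = (\<Sum>i\<in>Basis. (f(b := a)) i *\<^sub>R i)"
      have xi: "x \<bullet> i = (f(b := a)) i" if "i \<in> Basis" for i
        using that by (simp add: x_def)
      have "norm x = sqrt (\<Sum>i\<in>Basis. (x \<bullet> i)\<^sup>2)"
        by (simp add: norm_eq_sqrt_inner euclidean_inner[of x x] power2_eq_square)
      also have "(\<Sum>i\<in>Basis. (x \<bullet> i)\<^sup>2) = a\<^sup>2 + (\<Sum>i\<in>A. (x \<bullet> i)\<^sup>2)"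
        using A b xi[of b] by (subst A(4)[symmetric], subst sum.insert) auto
      also have "(\<Sum>i\<in>A. (x \<bullet> i)\<^sup>2) = S f"
        unfolding S_def
      proof (rule sum.cong)
        fix i assume "i \<in> A"
        then show "(x \<bullet> i)\<^sup>2 = (f i)\<^sup>2" using A xi[of i] by (metis fun_upd_other insertI2)
      qed simp
      finally have nx: "norm x = sqrt (a\<^sup>2 + S f)" .
      have "a\<^sup>2 + S f > 0" using that S0[of f] by (simp add: add_pos_nonneg)
      moreover have "x \<bullet> b = a" using xi[OF b] by simp
      moreover have "x \<noteq> 0" using that \<open>x \<bullet> b = a\<close> by auto
      ultimately show ?thesis unfolding x_def[symmetric] S_def[symmetric] \<Phi>_def
        by (auto simp: nx indicator_def)
    qed
    then show ?thesis
      using nn_integral_cone_slice[OF g A(1,2), of "\<bar>a\<bar>"] that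
      by (simp add: V_def N_def Q_def)
  qed
  have "(\<integral>\<^sup>+x. \<Phi> x \<partial>lborel) = (\<integral>\<^sup>+f. \<Phi> (\<Sum>i\<in>Basis. f i *\<^sub>R i) \<partial>Pi\<^sub>M Basis (\<lambda>_. lborel))"
    by (subst lborel_eq) (simp add: nn_integral_distr)
  also have "\<dots> = (\<integral>\<^sup>+a. \<integral>\<^sup>+f. \<Phi> (\<Sum>i\<in>Basis. (f(b := a)) i *\<^sub>R i) \<partial>Pi\<^sub>M A (\<lambda>_. lborel) \<partial>lborel)"
    by (subst A(4)[symmetric], subst product_nn_integral_insert_rev) (use A in simp_all)
  also have "\<dots> = (\<integral>\<^sup>+a. \<integral>\<^sup>+t. g t * (ennreal (V * real N * \<bar>a\<bar> ^ N * Q t) * indicator {\<bar>a\<bar><..<1} t) \<partial>lborel \<partial>lborel)"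
  proof (rule nn_integral_cong_AE)
    \<comment> \<open>The slice formula requires a nonzero height; the slice a = 0 is a single point
      of the outer integral.\<close>
    have "AE a in lborel. a \<notin> {0::real}"
      by (intro AE_not_in countable_imp_null_set_lborel) auto
    then show "AE a in lborel. (\<integral>\<^sup>+f. \<Phi> (\<Sum>i\<in>Basis. (f(b := a)) i *\<^sub>R i) \<partial>Pi\<^sub>M A (\<lambda>_. lborel)) =
      (\<integral>\<^sup>+t. g t * (ennreal (V * real N * \<bar>a\<bar> ^ N * Q t) * indicator {\<bar>a\<bar><..<1} t) \<partial>lborel)"
      by (rule eventually_mono) (use inner in auto)
  qed
  also have "\<dots> = (\<integral>\<^sup>+a. \<integral>\<^sup>+t. (g t * ennreal (V * real N * Q t) * indicator {0<..<1} t) * (ennreal (\<bar>a\<bar> ^ N) * indicator {-t<..<t} a) \<partial>lborel \<partial>lborel)"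
  proof (intro nn_integral_cong)
    fix a t :: real
    have "ennreal (V * real N * \<bar>a\<bar> ^ N * Q t) = ennreal (V * real N * Q t) * ennreal (\<bar>a\<bar> ^ N)"
      by (subst ennreal_mult''[symmetric]) (auto simp: mult_ac)
    then show "g t * (ennreal (V * real N * \<bar>a\<bar> ^ N * Q t) * indicator {\<bar>a\<bar><..<1} t) =
      (g t * ennreal (V * real N * Q t) * indicator {0<..<1} t) * (ennreal (\<bar>a\<bar> ^ N) * indicator {-t<..<t} a)"
      by (auto simp: indicator_def mult.assoc)
  qed
  also have "\<dots> = (\<integral>\<^sup>+t. \<integral>\<^sup>+a. (g t * ennreal (V * real N * Q t) * indicator {0<..<1} t) * (ennreal (\<bar>a\<bar> ^ N) * indicator {-t<..<t} a) \<partial>lborel \<partial>lborel)"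
  proof (rule lborel_pair.Fubini')
    have [measurable]: "Measurable.pred (lborel \<Otimes>\<^sub>M lborel) (\<lambda>(t::real, a). a \<in> {-t<..<t})"
      unfolding greaterThanLessThan_iff by measurable
    show "(\<lambda>(t, a). g t * ennreal (V * real N * Q t) * indicator {0<..<1} t * (ennreal (\<bar>a\<bar> ^ N) * indicator {-t<..<t} a))
      \<in> borel_measurable (lborel \<Otimes>\<^sub>M lborel)"
      unfolding indicator_def by measurable
  qed
  also have "\<dots> = (\<integral>\<^sup>+t. (g t * ennreal (V * real N * Q t) * indicator {0<..<1} t) * ennreal (2 * t ^ Suc N / real (Suc N)) \<partial>lborel)"
  proof (rule nn_integral_cong)
    fix t :: real
    show "(\<integral>\<^sup>+a. (g t * ennreal (V * real N * Q t) * indicator {0<..<1} t) * (ennreal (\<bar>a\<bar> ^ N) * indicator {-t<..<t} a) \<partial>lborel)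
      = (g t * ennreal (V * real N * Q t) * indicator {0<..<1} t) * ennreal (2 * t ^ Suc N / real (Suc N))"
    proof (cases "t > 0")
      case True
      then show ?thesis by (subst nn_integral_cmult) (auto simp: nn_integral_abs_power_interval)
    qed simp
  qed
  also have "\<dots> = (\<integral>\<^sup>+t. ennreal (2 * real N * V / real (Suc N)) * (g t * (ennreal ((1 - t\<^sup>2) powr (real N / 2 - 1)) * indicator {0<..<1} t)) \<partial>lborel)"
  proof (rule nn_integral_cong)
    fix t :: real
    \<comment> \<open>All powers of t cancel: 2 - N from
      \<open>(1 / t\<^sup>2 - 1) powr (real N / 2 - 1)\<close>, -3 from \<open>Q\<close>, and N + 1
      from the integral over a.\<close>
    have "V * real N * Q t * (2 * t ^ Suc N / real (Suc N)) = 2 * real N * V / real (Suc N) * (1 - t\<^sup>2) powr (real N / 2 - 1)"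
      if t: "0 < t" "t < 1"
    proof -
      have p: "1 - t\<^sup>2 > 0" using t by (simp add: power_less_one_iff)
      have "1 / t\<^sup>2 - 1 = (1 - t\<^sup>2) * t powr (-2)" using t by (simp add: powr_minus field_simps)
      then have "(1 / t\<^sup>2 - 1) powr (real N / 2 - 1) = (1 - t\<^sup>2) powr (real N / 2 - 1) * (t powr (-2)) powr (real N / 2 - 1)"
        using p t by (simp only: powr_mult)
      also have "(t powr (-2)) powr (real N / 2 - 1) = t powr (2 - real N)"
        unfolding powr_powr by (rule arg_cong[where f = "(powr) t"]) simp
      finally have "(1 / t\<^sup>2 - 1) powr (real N / 2 - 1) = (1 - t\<^sup>2) powr (real N / 2 - 1) * t powr (2 - real N)" .
      moreover have "t powr (2 - real N) * t ^ Suc N / t ^ 3 = 1"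
      proof -
        have "t powr (2 - real N) * t ^ Suc N = t powr (2 - real N) * t powr real (Suc N)"
          using t by (simp only: powr_realpow)
        also have "\<dots> = t powr real 3"
          by (subst powr_add[symmetric]) simp
        also have "\<dots> = t ^ 3" using t by (simp only: powr_realpow)
        finally show ?thesis using t by simp
      qed
      ultimately have "Q t * t ^ Suc N = (1 - t\<^sup>2) powr (real N / 2 - 1)"
        unfolding Q_def by (simp add: field_simps)
      then show ?thesis by (simp add: field_simps)
    qed
    note eq = this
    show "(g t * ennreal (V * real N * Q t) * indicator {0<..<1} t) * ennreal (2 * t ^ Suc N / real (Suc N))
      = ennreal (2 * real N * V / real (Suc N)) * (g t * (ennreal ((1 - t\<^sup>2) powr (real N / 2 - 1)) * indicator {0<..<1} t))"
    proof (cases "0 < t \<and> t < 1")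
      case True
      have "ennreal (V * real N * Q t) * ennreal (2 * t ^ Suc N / real (Suc N)) =
        ennreal (2 * real N * V / real (Suc N)) * ennreal ((1 - t\<^sup>2) powr (real N / 2 - 1))"
        using True V Q0[of t] eq by (subst (1 2) ennreal_mult'[symmetric]) (simp_all del: power_Suc of_nat_Suc)
      then show ?thesis using True by (simp add: mult.assoc mult.left_commute[of _ "g t"])
    qed auto
  qed
  also have "\<dots> = ennreal (2 * real N * V / real (Suc N)) * (\<integral>\<^sup>+t. g t * (ennreal ((1 - t\<^sup>2) powr (real N / 2 - 1)) * indicator {0<..<1} t) \<partial>lborel)"
    by (rule nn_integral_cmult) measurable
  finally have I: "(\<integral>\<^sup>+x. \<Phi> x \<partial>lborel) = \<dots>" .
  have "(\<integral>\<^sup>+x. g \<bar>x \<bullet> b\<bar> \<partial>sphere_measure) = of_nat DIM('a) * (\<integral>\<^sup>+x. \<Phi> x \<partial>lborel)"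
    unfolding \<Phi>_def by (subst nn_integral_sphere_measure) (auto simp: divide_inverse mult.commute abs_mult)
  also have "\<dots> = (ennreal (real (Suc N)) * ennreal (2 * real N * V / real (Suc N))) * (\<integral>\<^sup>+t. g t * (ennreal ((1 - t\<^sup>2) powr (real N / 2 - 1)) * indicator {0<..<1} t) \<partial>lborel)"
    unfolding I using N Npos by (simp add: mult.assoc ennreal_of_nat_eq_real_of_nat)
  also have "ennreal (real (Suc N)) * ennreal (2 * real N * V / real (Suc N)) = ennreal (2 * real N * V)"
    by (subst ennreal_mult'[symmetric]) auto
  also have "(\<integral>\<^sup>+t. g t * (ennreal ((1 - t\<^sup>2) powr (real N / 2 - 1)) * indicator {0<..<1} t) \<partial>lborel) = (\<integral>\<^sup>+t. g t \<partial>height_measure (real N) 0)"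
    by (subst nn_integral_height_measure) (auto intro!: nn_integral_cong simp: indicator_def)
  finally show ?thesis unfolding V_def N sphere_const_def .
qed

section \<open>Rotation invariance of Lebesgue and surface measure\<close>

text \<open>Translation invariance together with invariance of the unit ball pins down the image of
  Lebesgue measure under an isometry; this works in every Euclidean space, without determinants.\<close>
lemma nn_integral_orthogonal_transformation:
  fixes T :: "'a::euclidean_space \<Rightarrow> 'a" and g :: "'a \<Rightarrow> ennreal"
  assumes T: "orthogonal_transformation T" and g[measurable]: "g \<in> borel_measurable borel"
  shows "(\<integral>\<^sup>+x. g (T x) \<partial>lborel) = (\<integral>\<^sup>+x. g x \<partial>lborel)"
proof -
  have lin: "linear T" using T by (rule orthogonal_transformation_linear)
  have Tm[measurable]: "T \<in> borel_measurable borel"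
    using lin by (simp add: borel_measurable_continuous_onI linear_continuous_on linear_conv_bounded_linear)
  have [measurable]: "ball 0 1 - {0} \<in> sets (borel :: ('a) measure)" "ball 0 1 \<in> sets (borel :: ('a) measure)"
    by auto
  let ?B = "ball 0 1 :: 'a set"
  have shift: "(\<integral>\<^sup>+x. h (x + c) \<partial>lborel) = (\<integral>\<^sup>+x. h x \<partial>lborel)"
    if [measurable]: "h \<in> borel_measurable borel" for h :: "'a \<Rightarrow> ennreal" and c
  proof -
    have "(\<integral>\<^sup>+x. h x \<partial>lborel) = (\<integral>\<^sup>+x. h x \<partial>distr lborel borel ((+) c))"
      by (simp add: lborel_distr_plus)
    then show ?thesis by (simp add: nn_integral_distr add.commute)
  qed
  have refl: "(\<integral>\<^sup>+x. h (c - x) \<partial>lborel) = (\<integral>\<^sup>+x. h x \<partial>lborel)"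
    if [measurable]: "h \<in> borel_measurable borel" for h :: "'a \<Rightarrow> ennreal" and c
    by (subst (2) lborel_affine[of "-1" c]) (auto simp: density_1 nn_integral_distr)
  obtain T' where T': "\<And>y. T (T' y) = y"
    using orthogonal_transformation_surj[OF T] by (metis surjD)
  \<comment> \<open>The volume of the ball is written as the integral over y of
    \<open>indicator ?B (y + T x)\<close>. After Fubini, x is shifted by a preimage of y, so the
    ball sees only T x and g sees T x - y. Integrating over y first then removes T from g, and the
    ball does not distinguish T x from x.\<close>
  have "(\<integral>\<^sup>+x. g (T x) \<partial>lborel) * emeasure lborel ?B = (\<integral>\<^sup>+x. g (T x) * (\<integral>\<^sup>+y. indicator ?B y \<partial>lborel) \<partial>lborel)"
    by (simp add: nn_integral_multc)
  also have "\<dots> = (\<integral>\<^sup>+x. \<integral>\<^sup>+y. g (T x) * indicator ?B (y + T x) \<partial>lborel \<partial>lborel)"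
    by (subst nn_integral_cmult) (auto simp: shift[of "indicator ?B"] intro!: nn_integral_cong borel_measurable_indicator')
  also have "\<dots> = (\<integral>\<^sup>+y. \<integral>\<^sup>+x. g (T x) * indicator ?B (y + T x) \<partial>lborel \<partial>lborel)"
    by (rule lborel_pair.Fubini') measurable
  also have "\<dots> = (\<integral>\<^sup>+y. \<integral>\<^sup>+x. g (T x - y) * indicator ?B (T x) \<partial>lborel \<partial>lborel)"
  proof (rule nn_integral_cong)
    fix y
    have "(\<integral>\<^sup>+x. g (T x) * indicator ?B (y + T x) \<partial>lborel) = (\<integral>\<^sup>+x. g (T (x + - T' y)) * indicator ?B (y + T (x + - T' y)) \<partial>lborel)"
      by (rule shift[symmetric]) measurable
    then show "(\<integral>\<^sup>+x. g (T x) * indicator ?B (y + T x) \<partial>lborel) = (\<integral>\<^sup>+x. g (T x - y) * indicator ?B (T x) \<partial>lborel)"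
      by (simp add: linear_diff[OF lin] T')
  qed
  also have "\<dots> = (\<integral>\<^sup>+x. \<integral>\<^sup>+y. g (T x - y) * indicator ?B (T x) \<partial>lborel \<partial>lborel)"
    by (rule lborel_pair.Fubini') measurable
  also have "\<dots> = (\<integral>\<^sup>+x. (\<integral>\<^sup>+y. g y \<partial>lborel) * indicator ?B x \<partial>lborel)"
    by (subst nn_integral_multc) (auto simp: refl indicator_def orthogonal_transformation_norm[OF T] intro!: nn_integral_cong)
  also have "\<dots> = (\<integral>\<^sup>+x. g x \<partial>lborel) * emeasure lborel ?B"
    by (simp add: nn_integral_cmult)
  finally have eq: "(\<integral>\<^sup>+x. g (T x) \<partial>lborel) * emeasure lborel ?B = (\<integral>\<^sup>+x. g x \<partial>lborel) * emeasure lborel ?B" .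
  have B: "emeasure lborel ?B = ennreal (unit_ball_vol (real DIM('a)))"
    using emeasure_ball[of 1 "0::'a"] by simp
  show ?thesis using eq unfolding B mult_right_ennreal_cancel
    by (metis not_le of_nat_0_le_iff unit_ball_vol_pos)
qed

text \<open>A rotation T carries \<open>norm v *\<^sub>R b\<close> to v, which reduces the claim to
  the basis vector b. Scaling b by the length of v, rather than normalising v, includes v = 0. The
  invariance is used for the cone formula in the ball, where T is an isometry of Lebesgue
  measure.\<close>

lemma nn_integral_sphere_measure_inner:
  fixes g :: "real \<Rightarrow> ennreal" and v :: "real^'k"
  assumes g[measurable]: "g \<in> borel_measurable borel" and d: "CARD('k::finite) \<ge> 2"
  shows "(\<integral>\<^sup>+x. g \<bar>x \<bullet> v\<bar> \<partial>sphere_measure) =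
    ennreal (sphere_const (CARD('k) - 1)) * (\<integral>\<^sup>+t. g (norm v * t) \<partial>height_measure (real (CARD('k) - 1)) 0)"
proof -
  have [measurable]: "ball 0 1 - {0} \<in> sets (borel :: (real^'k) measure)" "ball 0 1 \<in> sets (borel :: (real^'k) measure)"
    by auto
  obtain j :: 'k where True by simp
  define b where "b = (axis j 1 :: real^'k)"
  have b: "b \<in> Basis" by (simp add: b_def)
  have "norm (norm v *\<^sub>R b) = norm v" using b by simp
  then obtain T where T: "orthogonal_transformation T" "T (norm v *\<^sub>R b) = v"
    using orthogonal_transformation_exists by metis
  have Tm[measurable]: "T \<in> borel_measurable borel"
    using orthogonal_transformation_linear[OF T(1)]
    by (simp add: borel_measurable_continuous_onI linear_continuous_on linear_conv_bounded_linear)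
  have Tv: "T x \<bullet> v = norm v * (x \<bullet> b)" for x
    using T by (metis inner_scaleR_right orthogonal_transformation_def)
  have "(\<integral>\<^sup>+x. g \<bar>x \<bullet> v\<bar> \<partial>sphere_measure) =
     of_nat DIM(real^'k) * (\<integral>\<^sup>+x. g \<bar>(x /\<^sub>R norm x) \<bullet> v\<bar> * indicator (ball 0 1 - {0}) x \<partial>lborel)"
    by (rule nn_integral_sphere_measure) measurable
  also have "(\<integral>\<^sup>+x. g \<bar>(x /\<^sub>R norm x) \<bullet> v\<bar> * indicator (ball 0 1 - {0}) x \<partial>lborel) =
     (\<integral>\<^sup>+x. g \<bar>(T x /\<^sub>R norm (T x)) \<bullet> v\<bar> * indicator (ball 0 1 - {0}) (T x) \<partial>lborel)"
    by (rule nn_integral_orthogonal_transformation[OF T(1), symmetric]) measurable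
  also have "\<dots> = (\<integral>\<^sup>+x. g (norm v * \<bar>(x /\<^sub>R norm x) \<bullet> b\<bar>) * indicator (ball 0 1 - {0}) x \<partial>lborel)"
  proof (rule nn_integral_cong)
    fix x
    have n: "norm (T x) = norm x" using orthogonal_transformation_norm[OF T(1)] .
    then have "T x = 0 \<longleftrightarrow> x = 0" by (metis norm_eq_zero)
    then show "g \<bar>(T x /\<^sub>R norm (T x)) \<bullet> v\<bar> * indicator (ball 0 1 - {0}) (T x) =
      g (norm v * \<bar>(x /\<^sub>R norm x) \<bullet> b\<bar>) * indicator (ball 0 1 - {0}) x"
      by (auto simp: n Tv indicator_def abs_mult mult_ac)
  qed
  also have "of_nat DIM(real^'k) * \<dots> = (\<integral>\<^sup>+x. g (norm v * \<bar>x \<bullet> b\<bar>) \<partial>sphere_measure)"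
    by (rule nn_integral_sphere_measure[symmetric]) measurable
  also have "\<dots> = ennreal (sphere_const (CARD('k) - 1)) * (\<integral>\<^sup>+t. g (norm v * t) \<partial>height_measure (real (CARD('k) - 1)) 0)"
    using nn_integral_sphere_measure_inner_Basis[OF _ b, of "\<lambda>t. g (norm v * t)"] d by simp
  finally show ?thesis .
qed

subsection \<open>Great spheres\<close>

lemma onframe_exists:
  fixes V :: "(real^'m) set"
  assumes "subspace V" "dim V = CARD('k::finite)"
  shows "\<exists>u :: real^'m^'k. onframe u V"
proof -
  obtain B where B: "pairwise orthogonal B" "\<And>x. x \<in> B \<Longrightarrow> norm x = 1"
      "independent B" "card B = dim V" "span B = V"
    using orthonormal_basis_subspace[OF assms(1)] by metis
  have "finite B" using B(3) by (rule independent_imp_finite)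
  then obtain h :: "'k \<Rightarrow> real^'m" where h: "bij_betw h UNIV B"
    using B(4) assms(2) finite_same_card_bij[of "UNIV :: 'k set" B] by auto
  have "h i \<bullet> h j = (if i = j then 1 else 0)" for i j
  proof (cases "i = j")
    case True
    then show ?thesis using B(2)[of "h i"] h by (auto simp: bij_betw_def norm_eq_1)
  next
    case False
    then have "h i \<noteq> h j" using h by (auto simp: bij_betw_def inj_on_def)
    then show ?thesis using B(1) h False by (auto simp: pairwise_def orthogonal_def bij_betw_def)
  qed
  moreover have "range h = B" using h by (simp add: bij_betw_def)
  ultimately have "onframe (\<chi> j. h j) V" using B(5) by (simp add: onframe_def)
  then show ?thesis by blast
qed

lemma span_range_rows:
  fixes u :: "real^'m^'k"
  shows "span (range (\<lambda>j. u $ j)) = range (\<lambda>c :: real^'k. \<Sum>j\<in>UNIV. c $ j *\<^sub>R u $ j)"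
proof
  have "subspace (range (\<lambda>c :: real^'k. \<Sum>j\<in>UNIV. c $ j *\<^sub>R u $ j))"
    by (rule linear_subspace_image)
       (auto intro!: linearI simp: algebra_simps sum.distrib scaleR_sum_right)
  moreover have "range (\<lambda>j. u $ j) \<subseteq> range (\<lambda>c :: real^'k. \<Sum>j\<in>UNIV. c $ j *\<^sub>R u $ j)"
  proof clarify
    fix i
    have "u $ i = (\<Sum>j\<in>UNIV. axis i 1 $ j *\<^sub>R u $ j)"
      by (simp add: axis_def if_distrib[of "\<lambda>r. r *\<^sub>R _"] cong: if_cong)
    then show "u $ i \<in> range (\<lambda>c :: real^'k. \<Sum>j\<in>UNIV. c $ j *\<^sub>R u $ j)" by blast
  qed
  ultimately show "span (range (\<lambda>j. u $ j)) \<subseteq> range (\<lambda>c :: real^'k. \<Sum>j\<in>UNIV. c $ j *\<^sub>R u $ j)"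
    by (rule span_minimal[rotated])
  show "range (\<lambda>c :: real^'k. \<Sum>j\<in>UNIV. c $ j *\<^sub>R u $ j) \<subseteq> span (range (\<lambda>j. u $ j))"
    by (intro image_subsetI span_sum span_scale span_base) auto
qed

lemma norm_frame_combination:
  fixes u :: "real^'m^'k" and c :: "real^'k"
  assumes "onframe u V"
  shows "norm (\<Sum>j\<in>UNIV. c $ j *\<^sub>R u $ j) = norm c"
proof -
  have "(\<Sum>j\<in>UNIV. c $ j *\<^sub>R u $ j) \<bullet> (\<Sum>j\<in>UNIV. c $ j *\<^sub>R u $ j) = c \<bullet> c"
    using assms unfolding onframe_def
    by (simp add: inner_sum_left inner_sum_right inner_vec_def[of c] if_distrib[of "\<lambda>r. _ * r"] cong: if_cong)
  then show ?thesis by (simp add: norm_eq_sqrt_inner)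
qed

lemma inner_frame_combination:
  fixes u :: "real^'m^'k" and c :: "real^'k"
  shows "(\<Sum>j\<in>UNIV. c $ j *\<^sub>R u $ j) \<bullet> e = c \<bullet> (\<chi> j. u $ j \<bullet> e)"
  by (simp add: inner_sum_left inner_vec_def[of c])

text \<open>The vector of the inner products of the frame with e is the coordinate vector of the orthogonal
  projection of e to V, so its length is the cosine of the distance.\<close>
lemma dist_origin_frame:
  fixes u :: "real^'m^'k" and e :: "real^'m"
  assumes u: "onframe u V" and e: "norm e = 1"
  defines "v \<equiv> (\<chi> j. u $ j \<bullet> e)"
  shows "dist_origin e V = arccos (norm v)" "norm v \<le> 1"
    "\<And>x. x \<in> V \<Longrightarrow> x \<bullet> e \<le> norm v * norm x" "\<exists>x\<in>V. norm x = 1 \<and> x \<bullet> e = norm v"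
    "norm v = 1 \<Longrightarrow> e \<in> V"
proof -
  define L where "L c = (\<Sum>j\<in>UNIV. c $ j *\<^sub>R u $ j)" for c :: "real^'k"
  have V: "V = range L"
    using u span_range_rows[of u] unfolding onframe_def L_def[abs_def] by simp
  have nL: "norm (L c) = norm c" for c
    unfolding L_def using norm_frame_combination[OF u] .
  have iL: "L c \<bullet> e = c \<bullet> v" for c
    unfolding L_def v_def by (rule inner_frame_combination)
  show le: "x \<bullet> e \<le> norm v * norm x" if "x \<in> V" for x
    using that norm_cauchy_schwarz[of _ v] by (auto simp: V iL nL mult.commute)
  show ex: "\<exists>x\<in>V. norm x = 1 \<and> x \<bullet> e = norm v"
  proof (cases "v = 0")
    case True
    obtain j :: 'k where True by simp
    show ?thesis
      by (rule bexI[of _ "L (axis j 1)"]) (auto simp: V nL iL True)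
  next
    case False
    have "inverse (norm v) * (v \<bullet> v) = norm v"
      using False by (simp add: power2_norm_eq_inner[symmetric] power2_eq_square)
    \<comment> \<open>The maximum of the height on the great sphere is attained at the normalised
      projection of e.\<close>
    then show ?thesis using False
      by (intro bexI[of _ "L (v /\<^sub>R norm v)"]) (auto simp: V nL iL)
  qed
  then obtain x where x: "x \<in> V" "norm x = 1" "x \<bullet> e = norm v" by blast
  then show n1: "norm v \<le> 1" using norm_cauchy_schwarz[of x e] e by simp
  show "dist_origin e V = arccos (norm v)"
    unfolding dist_origin_def
  proof (rule cInf_eq_minimum)
    show "arccos (norm v) \<in> sph_dist e ` great_sphere V"
      using x by (auto simp: great_sphere_def sph_dist_def image_iff inner_commute intro!: bexI[of _ x])
    fix y assume "y \<in> sph_dist e ` great_sphere V"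
    then obtain z where z: "z \<in> V" "norm z = 1" "y = arccos (e \<bullet> z)"
      by (auto simp: great_sphere_def sph_dist_def)
    have "e \<bullet> z \<le> norm v" using le[OF z(1)] z(2) by (simp add: inner_commute)
    moreover have "\<bar>e \<bullet> z\<bar> \<le> 1" using Cauchy_Schwarz_ineq2[of e z] e z by simp
    ultimately show "arccos (norm v) \<le> y" unfolding z(3) using n1 by (intro arccos_le_arccos) auto
  qed
  show "e \<in> V" if "norm v = 1"
  proof -
    \<comment> \<open>The expanded square is 1 - 2 + 1 when the projection \<open>L v\<close> has
      length 1.\<close>
    have "(e - L v) \<bullet> (e - L v) = e \<bullet> e - 2 * (L v \<bullet> e) + L v \<bullet> L v"
      by (simp add: inner_diff_left inner_diff_right inner_commute)
    also have "\<dots> = 0" using e nL[of v] that by (simp add: iL norm_eq_1)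
    finally show ?thesis by (auto simp: V)
  qed
qed

text \<open>Frees the preceding facts from the frame: afterwards a great sphere enters only through
  c = cos d, the largest height on it.\<close>

lemma dist_origin_bounds:
  fixes V :: "(real^'m) set"
  assumes V: "subspace V" "dim V = CARD('k::finite)" and e: "norm e = 1"
  shows "0 \<le> cos (dist_origin e V)" "cos (dist_origin e V) \<le> 1"
    "dist_origin e V = arccos (cos (dist_origin e V))"
    "sin (dist_origin e V) = sqrt (1 - (cos (dist_origin e V))\<^sup>2)"
    "\<And>x. x \<in> V \<Longrightarrow> x \<bullet> e \<le> cos (dist_origin e V) * norm x"
    "\<exists>x\<in>V. norm x = 1 \<and> x \<bullet> e = cos (dist_origin e V)"
    "cos (dist_origin e V) = 1 \<Longrightarrow> e \<in> V"
proof -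
  obtain u :: "real^'m^'k" where "onframe u V" using onframe_exists[OF V] by blast
  note d = dist_origin_frame[OF this e]
  have c: "cos (dist_origin e V) = norm (\<chi> j. u $ j \<bullet> e)"
    using d(2) by (simp add: d(1) cos_arccos order_trans[OF _ norm_ge_zero])
  show "0 \<le> cos (dist_origin e V)" "cos (dist_origin e V) \<le> 1"
    "dist_origin e V = arccos (cos (dist_origin e V))"
    "\<And>x. x \<in> V \<Longrightarrow> x \<bullet> e \<le> cos (dist_origin e V) * norm x"
    "\<exists>x\<in>V. norm x = 1 \<and> x \<bullet> e = cos (dist_origin e V)"
    "cos (dist_origin e V) = 1 \<Longrightarrow> e \<in> V"
    unfolding c by (fact d | simp)+
  show "sin (dist_origin e V) = sqrt (1 - (cos (dist_origin e V))\<^sup>2)"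
    unfolding c unfolding d(1) using d(2) by (intro sin_arccos) (auto intro: order_trans[OF _ norm_ge_zero])
qed

lemma radon_param_measurable [measurable]:
  "radon_param TYPE('k::finite) V \<in> borel_measurable borel"
  unfolding radon_param_def Let_def
  by (intro borel_measurable_sum borel_measurable_scaleR measurable_const borel_measurable_continuous_onI)
     (auto intro: continuous_intros)

text \<open>The height of the parametrised point is the inner product of the parameter with a vector
  of length cos d. This is where the heights of the k-sphere get scaled by c.\<close>

lemma nn_integral_radon_param:
  fixes V :: "(real^'m) set" and g :: "real \<Rightarrow> ennreal"
  assumes [measurable]: "g \<in> borel_measurable borel"
    and V: "subspace V" "dim V = CARD('k::finite)" and e: "norm e = 1" and k: "CARD('k) = k + 1" "k \<ge> 1"
  shows "(\<integral>\<^sup>+x. g \<bar>radon_param TYPE('k) V x \<bullet> e\<bar> \<partial>sphere_measure) =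
    ennreal (sphere_const k) * (\<integral>\<^sup>+t. g (cos (dist_origin e V) * t) \<partial>height_measure (real k) 0)"
proof -
  define u :: "real^'m^'k" where "u = (SOME u. onframe u V)"
  have u: "onframe u V" unfolding u_def by (rule someI_ex[OF onframe_exists[OF V]])
  note d = dist_origin_frame[OF u e]
  have c: "cos (dist_origin e V) = norm (\<chi> j. u $ j \<bullet> e)"
    using d(2) by (simp add: d(1) cos_arccos order_trans[OF _ norm_ge_zero])
  have "radon_param TYPE('k) V x \<bullet> e = x \<bullet> (\<chi> j. u $ j \<bullet> e)" for x
    unfolding radon_param_def u_def[symmetric] Let_def by (rule inner_frame_combination)
  then show ?thesis
    using nn_integral_sphere_measure_inner[of g "\<chi> j. u $ j \<bullet> e"] k by (simp add: c)
qed

section \<open>The weighted measure of a set of heights\<close>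

text \<open>Outside [-1, 1] the defining predicate of \<open>arccos\<close> has no solution, so the
  value there is one and the same default, represented by \<open>arccos 2\<close>. What remains is a
  function continuous on a closed interval and constant elsewhere.\<close>

lemma borel_measurable_arccos [measurable]: "arccos \<in> borel_measurable borel"
proof -
  have "(\<lambda>x. if x \<in> {-1..1} then arccos x else arccos 2) \<in> borel_measurable borel"
    by (rule borel_measurable_continuous_on_if) (auto intro!: continuous_on_arccos' continuous_intros)
  moreover have "(if x \<in> {-1..1} then arccos x else arccos 2) = arccos x" for x
  proof (cases "x \<in> {-1..1}")
    case False
    then have "(\<lambda>t. 0 \<le> t \<and> t \<le> pi \<and> cos t = x) = (\<lambda>t. False)"
      by (auto simp: fun_eq_iff cos_le_one)
    moreover have "(\<lambda>t. 0 \<le> t \<and> t \<le> pi \<and> cos t = 2) = (\<lambda>t. False)"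
    proof
      fix t :: real
      have "cos t \<noteq> 2" using cos_le_one[of t] by linarith
      then show "(0 \<le> t \<and> t \<le> pi \<and> cos t = 2) = False" by blast
    qed
    ultimately show ?thesis using False unfolding arccos_def by simp
  qed simp
  ultimately show ?thesis by simp
qed

text \<open>At height t the sine is sqrt (1 - t^2), so its power a1 raises the exponent n/2 - 1 of
  the height density to (a1 + n)/2 - 1.\<close>

lemma emeasure_weighted_sphere:
  fixes i0 :: "'m::finite"
  defines "e \<equiv> axis i0 1 :: real^'m"
  assumes E[measurable]: "E \<in> sets borel" and n: "CARD('m) = n + 1" "n \<ge> 1"
  shows "emeasure (weighted_sphere e a1 a2) {x. \<bar>x \<bullet> e\<bar> \<in> E} =
    ennreal (sphere_const n) * emeasure (height_measure (a1 + real n) a2) E"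
proof -
  have b: "e \<in> Basis" by (simp add: e_def)
  define h :: "real \<Rightarrow> ennreal" where "h t = ennreal (sqrt (1 - t\<^sup>2) powr a1 * t powr a2) * indicator E t" for t
  have [measurable]: "h \<in> borel_measurable borel" unfolding h_def[abs_def] by measurable
  define G :: "real^'m \<Rightarrow> ennreal" where "G x = ennreal (sin (arccos (e \<bullet> x)) powr a1 * \<bar>cos (arccos (e \<bullet> x))\<bar> powr a2) * indicator {x. \<bar>x \<bullet> e\<bar> \<in> E} x" for x
  have [measurable]: "(\<lambda>x. sin (arccos (e \<bullet> x)) powr a1 * \<bar>cos (arccos (e \<bullet> x))\<bar> powr a2) \<in> borel_measurable borel"
    by measurable
  have [measurable]: "{x. \<bar>x \<bullet> e\<bar> \<in> E} \<in> sets borel" by measurable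
  have [measurable]: "G \<in> borel_measurable borel" unfolding G_def[abs_def] by measurable
  have "emeasure (weighted_sphere e a1 a2) {x. \<bar>x \<bullet> e\<bar> \<in> E} = (\<integral>\<^sup>+x. G x \<partial>sphere_measure)"
    unfolding weighted_sphere_def G_def sph_dist_def by (subst emeasure_density) auto
  also have "\<dots> = of_nat DIM(real^'m) * (\<integral>\<^sup>+x. G (x /\<^sub>R norm x) * indicator (ball 0 1 - {0}) x \<partial>lborel)"
    by (rule nn_integral_sphere_measure) measurable
  also have "(\<integral>\<^sup>+x. G (x /\<^sub>R norm x) * indicator (ball 0 1 - {0}) x \<partial>lborel) =
     (\<integral>\<^sup>+x. h \<bar>(x /\<^sub>R norm x) \<bullet> e\<bar> * indicator (ball 0 1 - {0}) x \<partial>lborel)"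
  proof (rule nn_integral_cong)
    fix x :: "real^'m"
    \<comment> \<open>The formulas with sine and cosine of \<open>arccos\<close> simplify only for
      inner products in [-1, 1]. The detour through the cone formula provides this, since there the
      argument always has norm 1.\<close>
    have "G y = h \<bar>y \<bullet> e\<bar>" if "norm y = 1" for y
    proof -
      have "\<bar>y \<bullet> e\<bar> \<le> 1" using Cauchy_Schwarz_ineq2[of y e] that b by simp
      then show ?thesis by (simp add: G_def h_def sin_arccos_abs inner_commute indicator_def abs_le_iff)
    qed
    from this[of "x /\<^sub>R norm x"]
    show "G (x /\<^sub>R norm x) * indicator (ball 0 1 - {0}) x = h \<bar>(x /\<^sub>R norm x) \<bullet> e\<bar> * indicator (ball 0 1 - {0}) x"
      by (auto simp: indicator_def)
  qed
  also have "of_nat DIM(real^'m) * \<dots> = (\<integral>\<^sup>+x. h \<bar>x \<bullet> e\<bar> \<partial>sphere_measure)"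
    by (rule nn_integral_sphere_measure[symmetric]) measurable
  also have "\<dots> = ennreal (sphere_const n) * (\<integral>\<^sup>+t. h t \<partial>height_measure (real n) 0)"
    using nn_integral_sphere_measure_inner_Basis[OF _ b, of h] n by simp
  also have "(\<integral>\<^sup>+t. h t \<partial>height_measure (real n) 0) = emeasure (height_measure (a1 + real n) a2) E"
  proof -
    have "h t * (ennreal ((1 - t\<^sup>2) powr (real n / 2 - 1) * t powr 0) * indicator {0<..<1} t) =
      ennreal ((1 - t\<^sup>2) powr ((a1 + real n) / 2 - 1) * t powr a2) * indicator (E \<inter> {0<..<1}) t" for t
    proof (cases "0 < t \<and> t < 1 \<and> t \<in> E")
      case True
      have "1 - t\<^sup>2 > 0" using True by (intro one_minus_square_pos) auto
      then have "sqrt (1 - t\<^sup>2) powr a1 * (1 - t\<^sup>2) powr (real n / 2 - 1) = (1 - t\<^sup>2) powr (a1 / 2 + (real n / 2 - 1))"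
        unfolding powr_add by (simp add: powr_half_sqrt[symmetric] powr_powr)
      also have "a1 / 2 + (real n / 2 - 1) = (a1 + real n) / 2 - 1" by (simp add: field_simps)
      finally have "(sqrt (1 - t\<^sup>2) powr a1 * t powr a2) * (1 - t\<^sup>2) powr (real n / 2 - 1) =
        (1 - t\<^sup>2) powr ((a1 + real n) / 2 - 1) * t powr a2" by (simp add: mult_ac)
      then show ?thesis using True by (simp add: h_def ennreal_mult'[symmetric])
    qed (auto simp: h_def indicator_def)
    then show ?thesis
      by (subst nn_integral_height_measure) (auto simp: emeasure_height_measure)
  qed
  finally show ?thesis .
qed

section \<open>Tuples spanning a great sphere: null sets and sets of positive measure\<close>

text \<open>If e is a combination of the rows of w, then some row j is a combination of e and the other rows.
  So w is the image under a polynomial map of a tuple whose row j carries the coefficients, and since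
  there are fewer than CARD('m) of them, such tuples can be taken in a hyperplane.\<close>
lemma AE_not_in_span_rows:
  fixes e :: "real^'m"
  assumes card: "CARD('k::finite) < CARD('m)" and e: "e \<noteq> 0"
  shows "AE w in (lborel :: (real^'m^'k) measure). e \<notin> span (range (\<lambda>j. w $ j))"
proof -
  obtain m0 :: 'm where True by simp
  have "card (UNIV :: 'k set) \<le> card (UNIV - {m0})" using card by (simp add: card_Diff_subset)
  then obtain \<iota> :: "'k \<Rightarrow> 'm" where \<iota>: "range \<iota> \<subseteq> UNIV - {m0}" "inj \<iota>"
    using card_le_inj[of "UNIV :: 'k set" "UNIV - {m0}"] by auto
  \<comment> \<open>Coordinate \<iota> l of row j stores the coefficient of row l, and coordinate
    \<iota> j that of e. As m0 is not in the range of \<iota>, coordinate m0 of row j can be set to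
    0, which is the hyperplane \<open>H j\<close>.\<close>
  define \<psi> where "\<psi> j w = (\<Sum>l\<in>UNIV - {j}. w $ j $ \<iota> l *\<^sub>R w $ l) + w $ j $ \<iota> j *\<^sub>R e" for j :: 'k and w :: "real^'m^'k"
  define \<Phi> where "\<Phi> j w = w + axis j (\<psi> j w - w $ j)" for j :: 'k and w :: "real^'m^'k"
  define H where "H j = {w :: real^'m^'k. w $ j $ m0 = 0}" for j
  have negH: "negligible (H j)" for j
  proof -
    have "H j = {w. axis j (axis m0 1) \<bullet> w = 0}" by (simp add: H_def inner_axis')
    moreover have "axis j (axis m0 (1::real)) \<noteq> 0" by (simp add: axis_eq_0_iff)
    ultimately show ?thesis using negligible_hyperplane by metis
  qed
  have diff: "\<Phi> j differentiable_on H j" for j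
  proof -
    have lin: "bounded_linear (\<lambda>x :: real^'m. axis j x :: real^'m^'k)"
      by (auto intro!: linear_conv_bounded_linear[THEN iffD1] linearI simp: vec_eq_iff axis_def)
    have c1: "(\<lambda>w :: real^'m^'k. w $ j $ i) differentiable (at w)" for i w
      by (intro bounded_linear_imp_differentiable bounded_linear_compose[OF bounded_linear_vec_nth] bounded_linear_vec_nth)
    have c2: "(\<lambda>w :: real^'m^'k. w $ l) differentiable (at w)" for l w
      by (intro bounded_linear_imp_differentiable bounded_linear_vec_nth)
    have "\<psi> j differentiable (at w)" for w
      unfolding \<psi>_def[abs_def] by (intro differentiable_add differentiable_sum ballI differentiable_scaleR c1 c2 differentiable_const) auto
    then have "(\<lambda>w. \<psi> j w - w $ j) differentiable (at w)" for w
      by (intro differentiable_diff c2)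
    then have "(\<lambda>w. axis j (\<psi> j w - w $ j)) differentiable (at w)" for w
      using bounded_linear_imp_differentiable[OF lin] differentiable_chain_at[of "\<lambda>w. \<psi> j w - w $ j" w "axis j"]
      by (simp add: comp_def)
    then have "\<Phi> j differentiable (at w)" for w
      unfolding \<Phi>_def[abs_def] by (intro differentiable_add differentiable_ident)
    then show ?thesis by (simp add: differentiable_at_imp_differentiable_on)
  qed
  \<comment> \<open>\<Phi> j is a differentiable map of the space of tuples to itself, so it sends
    null sets to null sets.\<close>
  have "negligible (\<Phi> j ` H j)" for j
    by (rule negligible_differentiable_image_negligible[OF order_refl negH diff])
  then have neg: "negligible (\<Union>j. \<Phi> j ` H j)"
    by (intro negligible_countable_Union) (auto simp: uncountable_def countable_finite)
  have "w \<in> (\<Union>j. \<Phi> j ` H j)" if sp: "e \<in> span (range (\<lambda>j. w $ j))" for w :: "real^'m^'k"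
  proof -
    obtain c :: "real^'k" where c: "e = (\<Sum>j\<in>UNIV. c $ j *\<^sub>R w $ j)"
      using sp unfolding span_range_rows by blast
    have "\<exists>j. c $ j \<noteq> 0"
    proof (rule ccontr)
      assume "\<not> ?thesis"
      then have "e = 0" unfolding c by simp
      then show False using e by simp
    qed
    then obtain j where j: "c $ j \<noteq> 0" by blast
    \<comment> \<open>The coefficients obtained by solving the relation for e for its row j.\<close>
    define d where "d l = (if l = j then 1 / c $ j else - c $ l / c $ j)" for l
    define z :: "real^'m" where "z = (\<chi> i. if i \<in> range \<iota> then d (inv \<iota> i) else 0)"
    define w' where "w' = w + axis j (z - w $ j)"
    have zi: "z $ \<iota> l = d l" for l using \<iota>(2) by (simp add: z_def)
    have w'j: "w' $ j = z" by (simp add: w'_def)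
    have w'l: "w' $ l = w $ l" if "l \<noteq> j" for l using that by (simp add: w'_def axis_def)
    have "z $ m0 = 0" using \<iota>(1) by (auto simp: z_def)
    then have "w' \<in> H j" by (simp add: H_def w'j)
    moreover have "w = \<Phi> j w'"
    proof -
      have "e = c $ j *\<^sub>R w $ j + (\<Sum>l\<in>UNIV - {j}. c $ l *\<^sub>R w $ l)"
        unfolding c by (subst sum.remove[of UNIV j]) auto
      then have "(1 / c $ j) *\<^sub>R e = w $ j + (\<Sum>l\<in>UNIV - {j}. (c $ l / c $ j) *\<^sub>R w $ l)"
        using j by (simp add: scaleR_add_right scaleR_sum_right)
      moreover have "\<psi> j w' = (\<Sum>l\<in>UNIV - {j}. (- c $ l / c $ j) *\<^sub>R w $ l) + (1 / c $ j) *\<^sub>R e"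
        unfolding \<psi>_def w'j zi by (intro arg_cong2[where f = "(+)"] sum.cong) (auto simp: d_def w'l)
      ultimately have "\<psi> j w' = w $ j" by (simp add: sum_negf)
      then show ?thesis by (simp add: \<Phi>_def w'j vec_eq_iff) (simp add: w'_def axis_def)
    qed
    ultimately show ?thesis by blast
  qed
  then have "negligible {w :: real^'m^'k. e \<in> span (range (\<lambda>j. w $ j))}"
    by (intro negligible_subset[OF neg]) auto
  then have "AE w in lebesgue. w \<notin> {w :: real^'m^'k. e \<in> span (range (\<lambda>j. w $ j))}"
    unfolding negligible_iff_null_sets by (rule AE_not_in)
  then show ?thesis by (simp add: AE_completion_iff)
qed

lemma norm_rows_combination_le:
  fixes w :: "real^'m^'k" and c :: "real^'k"
  shows "norm (\<Sum>j\<in>UNIV. c $ j *\<^sub>R w $ j) \<le> norm c * norm w"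
proof -
  have "norm (\<Sum>j\<in>UNIV. c $ j *\<^sub>R w $ j) \<le> (\<Sum>j\<in>UNIV. \<bar>c $ j\<bar> * \<bar>norm (w $ j)\<bar>)"
    by (rule order_trans[OF norm_sum]) simp
  also have "\<dots> \<le> L2_set (\<lambda>j. c $ j) UNIV * L2_set (\<lambda>j. norm (w $ j)) UNIV"
    by (rule L2_set_mult_ineq)
  also have "\<dots> = norm c * norm w" by (simp add: norm_vec_def L2_set_def)
  finally show ?thesis .
qed

text \<open>An explicit orthonormal tuple \<open>w0\<close> has cos d = c0, the midpoint of the
  interval. All tuples in a small ball around it span subspaces of full dimension with cos d still
  between \<alpha> and \<beta>. The ball has positive measure, so it meets every property that holds
  almost everywhere.\<close>

lemma ex_Xi_height_between:
  fixes i0 :: "'m::finite"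
  defines "e \<equiv> axis i0 1 :: real^'m"
  assumes card: "CARD('k::finite) < CARD('m)" "CARD('k) = k + 1"
    and ab: "0 < \<alpha>" "\<alpha> < \<beta>" "\<beta> < 1"
    and P: "AE w in (lborel :: (real^'m^'k) measure). P w"
  shows "\<exists>w. P w \<and> Xi e k (span (range (\<lambda>j. w $ j))) \<and>
    \<alpha> < cos (dist_origin e (span (range (\<lambda>j. w $ j)))) \<and> cos (dist_origin e (span (range (\<lambda>j. w $ j)))) < \<beta>"
proof -
  define c0 where "c0 = (\<alpha> + \<beta>) / 2"
  \<comment> \<open>Moving the tuple by less than \<eta> changes cos d by at most 2 \<eta>, a third
    of \<beta> - \<alpha>, whereas c0 is half of it away from either end.\<close>
  define \<eta> where "\<eta> = (\<beta> - \<alpha>) / 6"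
  have \<eta>: "0 < \<eta>" "\<eta> < 1 / 2" using ab by (auto simp: \<eta>_def)
  have c0: "0 < c0" "c0 < 1" using ab by (auto simp: c0_def)
  have e: "norm e = 1" by (simp add: e_def)
  obtain j0 :: 'k where True by simp
  have "card (UNIV :: 'k set) \<le> card (UNIV - {i0})" using card by (simp add: card_Diff_subset)
  then obtain \<iota> :: "'k \<Rightarrow> 'm" where \<iota>: "range \<iota> \<subseteq> UNIV - {i0}" "inj \<iota>"
    using card_le_inj[of "UNIV :: 'k set" "UNIV - {i0}"] by auto
  have \<iota>0: "\<iota> j \<noteq> i0" for j using \<iota>(1) by auto
  have \<iota>i: "\<iota> i = \<iota> j \<longleftrightarrow> i = j" for i j using \<iota>(2) by (auto simp: inj_on_def)
  \<comment> \<open>Only row j0 is tilted towards e, by the cosine c0; the other rows are orthogonal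
    to e.\<close>
  define w0 :: "real^'m^'k" where
    "w0 = (\<chi> j. if j = j0 then c0 *\<^sub>R e + sqrt (1 - c0\<^sup>2) *\<^sub>R axis (\<iota> j) 1 else axis (\<iota> j) 1)"
  have c02: "c0 * c0 \<le> 1" using c0 by (simp add: mult_le_one)
  have frame: "w0 $ i \<bullet> w0 $ j = (if i = j then 1 else 0)" for i j
    using c02 by (auto simp: w0_def e_def inner_add_left inner_add_right inner_axis_axis \<iota>0 \<iota>0[symmetric] \<iota>i power2_eq_square)
  then have on: "onframe w0 (span (range (\<lambda>j. w0 $ j)))" by (simp add: onframe_def)
  have w0e: "(\<Sum>j\<in>UNIV. a $ j *\<^sub>R w0 $ j) \<bullet> e = a $ j0 * c0" for a :: "real^'k"
  proof -
    have "w0 $ j \<bullet> e = (if j = j0 then c0 else 0)" for j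
      by (simp add: w0_def e_def inner_add_left inner_axis_axis \<iota>0)
    then show ?thesis by (simp add: inner_sum_left if_distrib[of "\<lambda>r. _ * r"] cong: if_cong)
  qed
  have main: "Xi e k (span (range (\<lambda>j. w $ j))) \<and>
    \<alpha> < cos (dist_origin e (span (range (\<lambda>j. w $ j)))) \<and> cos (dist_origin e (span (range (\<lambda>j. w $ j)))) < \<beta>"
    if w: "w \<in> ball w0 \<eta>" for w
  proof -
    define V where "V = span (range (\<lambda>j. w $ j))"
    define L where "L a = (\<Sum>j\<in>UNIV. a $ j *\<^sub>R w $ j)" for a :: "real^'k"
    define L0 where "L0 a = (\<Sum>j\<in>UNIV. a $ j *\<^sub>R w0 $ j)" for a :: "real^'k"
    have VL: "V = range L" unfolding V_def L_def[abs_def] by (rule span_range_rows)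
    have lin: "linear L"
      unfolding L_def[abs_def] by (auto intro!: linearI simp: algebra_simps sum.distrib scaleR_sum_right)
    have close: "norm (L a - L0 a) \<le> norm a * \<eta>" for a
    proof -
      have "L a - L0 a = (\<Sum>j\<in>UNIV. a $ j *\<^sub>R (w - w0) $ j)"
        by (simp add: L_def L0_def sum_subtractf scaleR_diff_right)
      also have "norm \<dots> \<le> norm a * norm (w - w0)" by (rule norm_rows_combination_le)
      also have "\<dots> \<le> norm a * \<eta>" using w by (intro mult_left_mono) (auto simp: dist_norm norm_minus_commute)
      finally show ?thesis .
    qed
    have nL0: "norm (L0 a) = norm a" for a unfolding L0_def by (rule norm_frame_combination[OF on])
    have lower: "norm a * (1 - \<eta>) \<le> norm (L a)" for a
      using close[of a] norm_triangle_ineq2[of "L0 a" "L0 a - L a"] nL0[of a] by (simp add: algebra_simps norm_minus_commute)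
    have upper: "norm (L a) \<le> norm a * (1 + \<eta>)" for a
      using close[of a] norm_triangle_ineq[of "L0 a" "L a - L0 a"] nL0[of a] by (simp add: algebra_simps)
    have "a = 0" if "L a = 0" for a
      using lower[of a] that \<eta> by (simp add: mult_le_0_iff)
    then have inj: "inj L" using linear_injective_0[OF lin] by blast
    have dim: "dim V = CARD('k)"
      unfolding VL using dim_image_eq[OF lin, of UNIV] inj by simp
    have sub: "subspace V" by (simp add: V_def)
    note d = dist_origin_bounds[where 'k = 'k, OF sub dim e]
    define c where "c = cos (dist_origin e V)"
    have "\<alpha> < c"
    proof -
      \<comment> \<open>The perturbed row j0 is a vector of V of height at least c0 - \<eta>, and
        cos d bounds height over length.\<close>
      define x where "x = L (axis j0 1)"
      have "x \<bullet> e \<ge> c0 - \<eta>"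
      proof -
        have "L0 (axis j0 1) \<bullet> e = c0" unfolding L0_def w0e by simp
        moreover have "\<bar>(x - L0 (axis j0 1)) \<bullet> e\<bar> \<le> \<eta>"
          using Cauchy_Schwarz_ineq2[of "x - L0 (axis j0 1)" e] close[of "axis j0 1"] e by (simp add: x_def)
        ultimately show ?thesis by (simp add: inner_diff_left)
      qed
      moreover have "x \<bullet> e \<le> c * norm x" using d(5)[of x] by (simp add: c_def VL x_def)
      moreover have "c * norm x \<le> c * (1 + \<eta>)"
        using d(1) upper[of "axis j0 1"] by (intro mult_left_mono) (auto simp: c_def x_def)
      moreover have "c * \<eta> \<le> \<eta>" using d(1,2) \<eta> by (simp add: c_def mult_le_cancel_right1)
      ultimately have "c0 - 2 * \<eta> \<le> c" by (simp add: algebra_simps)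
      then show ?thesis using ab by (simp add: c0_def \<eta>_def field_simps)
    qed
    moreover have "c < \<beta>"
    proof -
      obtain a where a: "norm (L a) = 1" "L a \<bullet> e = c"
        using d(6) unfolding VL c_def by auto
      have "c = L0 a \<bullet> e + (L a - L0 a) \<bullet> e" using a by (simp add: inner_diff_left)
      moreover have "L0 a \<bullet> e \<le> norm a * c0"
        unfolding L0_def w0e using c0 component_le_norm_cart[of a j0] by (intro mult_right_mono) auto
      moreover have "(L a - L0 a) \<bullet> e \<le> norm a * \<eta>"
        using norm_cauchy_schwarz[of "L a - L0 a" e] close[of a] e by simp
      ultimately have "c \<le> norm a * (c0 + \<eta>)" by (simp add: algebra_simps)
      then have "c * (1 - \<eta>) \<le> norm a * (c0 + \<eta>) * (1 - \<eta>)" using \<eta> by (intro mult_right_mono) auto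
      also have "\<dots> = (norm a * (1 - \<eta>)) * (c0 + \<eta>)" by simp
      also have "\<dots> \<le> 1 * (c0 + \<eta>)" using lower[of a] a c0 \<eta> by (intro mult_right_mono) auto
      finally have "c \<le> c0 + \<eta> + c * \<eta>" by (simp add: algebra_simps)
      moreover have "c * \<eta> \<le> \<eta>" using d(1,2) \<eta> by (simp add: c_def mult_le_cancel_right1)
      ultimately have "c \<le> c0 + 2 * \<eta>" by linarith
      then show ?thesis using ab by (simp add: c0_def \<eta>_def field_simps)
    qed
    moreover have "Xi e k V"
    proof -
      have "c > 0" using \<open>\<alpha> < c\<close> ab by simp
      then have "arccos c < arccos 0" using d(2) by (intro arccos_less_arccos) (auto simp: c_def)
      then have "dist_origin e V < pi / 2" using d(3) by (simp add: c_def)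
      then show ?thesis using sub dim card by (simp add: Xi_def)
    qed
    ultimately show ?thesis by (simp add: c_def V_def)
  qed
  have "\<exists>w\<in>ball w0 \<eta>. P w"
  proof (rule ccontr)
    assume no: "\<not> ?thesis"
    obtain N where N: "{w \<in> space (lborel :: (real^'m^'k) measure). \<not> P w} \<subseteq> N" "emeasure lborel N = 0" "N \<in> sets lborel"
      using P by (rule AE_E)
    have "ball w0 \<eta> \<subseteq> N" using no N(1) by auto
    then have "emeasure lborel (ball w0 \<eta>) \<le> 0" using emeasure_mono[of _ N lborel] N by auto
    moreover have "emeasure lborel (ball w0 \<eta>) > 0" using \<eta> by (simp add: emeasure_ball)
    ultimately show False by simp
  qed
  then show ?thesis using main by blast
qed

subsection \<open>Sufficiency\<close>

text \<open>Both claims are Fubini for the region 0 < s < g x. The second is recorded because a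
  constant has to be moved under the integral over s later.\<close>

lemma nn_integral_layer_cake:
  fixes g :: "'a \<Rightarrow> real"
  assumes M: "sigma_finite_measure M" and [measurable]: "g \<in> borel_measurable M"
  shows "(\<integral>\<^sup>+x. ennreal (g x) \<partial>M) = (\<integral>\<^sup>+s. indicator {0<..} s * emeasure M {x \<in> space M. g x > s} \<partial>lborel)"
    and "(\<lambda>s. indicator {0<..} s * emeasure M {x \<in> space M. g x > s}) \<in> borel_measurable lborel"
proof -
  interpret M: sigma_finite_measure M by fact
  interpret pair_sigma_finite M "lborel :: real measure" ..
  have eq: "(\<integral>\<^sup>+x. indicator {0<..} s * indicator {..<g x} s \<partial>M) = indicator {0<..} s * emeasure M {x \<in> space M. g x > s}" for s :: real
  proof -
    have "(\<integral>\<^sup>+x. indicator {0<..} s * indicator {..<g x} s \<partial>M) = (\<integral>\<^sup>+x. indicator {0<..} s * indicator {x \<in> space M. g x > s} x \<partial>M)"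
      by (intro nn_integral_cong) (auto simp: indicator_def)
    then show ?thesis by (simp add: nn_integral_cmult)
  qed
  have m: "(\<lambda>(x, s). indicator {0<..} s * indicator {..<g x} s :: ennreal) \<in> borel_measurable (M \<Otimes>\<^sub>M lborel)"
  proof -
    have "(\<lambda>(x, s). if 0 < s \<and> s < g x then 1 else 0 :: ennreal) \<in> borel_measurable (M \<Otimes>\<^sub>M lborel)"
      by measurable
    moreover have "(\<lambda>(x, s). if 0 < s \<and> s < g x then 1 else 0 :: ennreal) = (\<lambda>(x, s). indicator {0<..} s * indicator {..<g x} s)"
      by (auto simp: fun_eq_iff indicator_def)
    ultimately show ?thesis by simp
  qed
  have "(\<integral>\<^sup>+x. ennreal (g x) \<partial>M) = (\<integral>\<^sup>+x. \<integral>\<^sup>+s. indicator {0<..} s * indicator {..<g x} s \<partial>lborel \<partial>M)"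
  proof (rule nn_integral_cong)
    fix x
    have "(\<integral>\<^sup>+s. indicator {0<..} s * indicator {..<g x} s \<partial>lborel) = (\<integral>\<^sup>+s. indicator {0<..<g x} s \<partial>lborel)"
      by (intro nn_integral_cong) (auto simp: indicator_def)
    also have "\<dots> = ennreal (g x)" by (cases "0 \<le> g x") (auto simp: ennreal_neg)
    finally show "ennreal (g x) = (\<integral>\<^sup>+s. indicator {0<..} s * indicator {..<g x} s \<partial>lborel)" by simp
  qed
  also have "\<dots> = (\<integral>\<^sup>+s. \<integral>\<^sup>+x. indicator {0<..} s * indicator {..<g x} s \<partial>M \<partial>lborel)"
    using m by (rule Fubini'[symmetric])
  finally show "(\<integral>\<^sup>+x. ennreal (g x) \<partial>M) = (\<integral>\<^sup>+s. indicator {0<..} s * emeasure M {x \<in> space M. g x > s} \<partial>lborel)"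
    by (simp add: eq)
  have "(\<lambda>s. \<integral>\<^sup>+x. indicator {0<..} s * indicator {..<g x} s \<partial>M) \<in> borel_measurable lborel"
    using measurable_pair_swap[OF m] by (intro M.borel_measurable_nn_integral) (simp add: case_prod_beta')
  then show "(\<lambda>s. indicator {0<..} s * emeasure M {x \<in> space M. g x > s}) \<in> borel_measurable lborel"
    by (simp add: eq)
qed

lemma epowr_ge:
  assumes le: "ennreal (K * x powr p) \<le> y" and p: "p > 0" and x: "x \<ge> 0" and K: "K \<ge> 0"
  shows "ennreal (K powr (1 / p) * x) \<le> epowr y (1 / p)"
proof (cases "y = \<infinity>")
  case False
  define r where "r = enn2real y"
  have "y = ennreal r" using False by (simp add: r_def less_top)
  then have "K * x powr p \<le> r" using le ennreal_le_iff[of r] by (metis r_def enn2real_nonneg)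
  then have "(K * x powr p) powr (1 / p) \<le> r powr (1 / p)"
    using K x p by (intro powr_mono2) auto
  moreover have "(K * x powr p) powr (1 / p) = K powr (1 / p) * x"
    using K x p by (simp add: powr_mult powr_powr)
  ultimately show ?thesis using False by (simp add: epowr_def r_def ennreal_leI)
qed (simp add: epowr_def)

text \<open>With second Lorentz index 1 the norm is itself an integral over the levels s, of the
  mass of the superlevel set to the power 1/p. So the estimate for sets can be integrated over s on
  both sides.\<close>

lemma radon_Linf_estimate_sufficient:
  fixes n k :: nat and a1 a2 g1 g2 :: real and i0 :: "'m::finite"
  assumes m: "CARD('m) = n + 1" and k: "CARD('k::finite) = k + 1" "1 \<le> k" and kn: "k < n" and a2: "a2 > 0"
    and g1: "g1 \<ge> 0" "g1 \<ge> (a1 + real n) / (1 + a2) - real k" and g2: "g2 \<ge> 1"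
    and kp: "real k * (1 + a2) \<ge> 2"
  shows "radon_Linf_estimate TYPE('k) (axis i0 1 :: real^'m) a1 a2 g1 g2"
proof -
  define e where "e = (axis i0 1 :: real^'m)"
  define p where "p = 1 + a2"
  define A where "A = a1 + real n"
  define W where "W = weighted_sphere e a1 a2"
  define h where "h = height_measure (real k) 0"
  have e: "norm e = 1" by (simp add: e_def)
  have k1: "real k \<ge> 1" using k by simp
  obtain K where K: "K > 0" and K_le:
    "\<And>c \<gamma> E. \<lbrakk>0 < c; c < 1; \<gamma> \<ge> 0; \<gamma> \<ge> A / p - real k; E \<in> sets borel\<rbrakk> \<Longrightarrow>
      ennreal (K * ((1 - c\<^sup>2) powr (\<gamma> / 2) * c * measure h {t. c * t \<in> E}) powr p)
        \<le> emeasure (height_measure A (p - 1)) E"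
    unfolding h_def using emeasure_height_measure_scaled_ge[of "real k" p A] k1 a2 kp unfolding p_def
    by (metis add_increasing2 less_eq_real_def)
  define B where "B = (sphere_const n * K) powr (1 / p)"
  have sn: "sphere_const n > 0" "sphere_const k > 0" using kn k by (auto intro: sphere_const_pos)
  have B: "B > 0" using K sn by (simp add: B_def)
  have p: "p > 1" using a2 by (simp add: p_def)
  have hfin: "emeasure h E < \<infinity>" for E unfolding h_def by (rule emeasure_height_measure_finite[OF k1])
  have hsig: "sigma_finite_measure h"
    by (rule finite_measure.axioms(1), rule finite_measureI) (metis hfin less_irrefl)
  have hsets[simp, measurable_cong]: "sets h = sets borel" by (simp add: h_def)
  have hspace[simp]: "space h = UNIV" by (simp add: h_def)
  have set_le: "ennreal (B * ((1 - c\<^sup>2) powr (g1 / 2) * c)) * emeasure h {t. c * t \<in> E}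
      \<le> epowr (emeasure W {x. \<bar>x \<bullet> e\<bar> \<in> E}) (1 / p)"
    if c: "0 < c" "c < 1" and E: "E \<in> sets borel" for c E
  proof -
    define x where "x = (1 - c\<^sup>2) powr (g1 / 2) * c * measure h {t. c * t \<in> E}"
    have "ennreal (sphere_const n * K * x powr p) = ennreal (sphere_const n) * ennreal (K * x powr p)"
      using sn K by (simp add: ennreal_mult'[symmetric] mult.assoc)
    also have "\<dots> \<le> ennreal (sphere_const n) * emeasure (height_measure A (p - 1)) E"
      using K_le[OF c g1(1) _ E] g1(2) unfolding x_def A_def p_def by (intro mult_left_mono) auto
    also have "\<dots> = emeasure W {x. \<bar>x \<bullet> e\<bar> \<in> E}"
      unfolding W_def e_def using emeasure_weighted_sphere[OF E m] kn by (simp add: A_def p_def)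
    finally have "ennreal ((sphere_const n * K) powr (1 / p) * x) \<le> epowr (emeasure W {x. \<bar>x \<bullet> e\<bar> \<in> E}) (1 / p)"
      using p sn K c by (intro epowr_ge) (auto simp: x_def)
    moreover have "emeasure h {t. c * t \<in> E} = ennreal (measure h {t. c * t \<in> E})"
      using hfin by (intro emeasure_eq_ennreal_measure) (auto simp: less_top)
    ultimately show ?thesis using B c
      by (simp add: B_def x_def ennreal_mult'[symmetric] mult.assoc)
  qed
  show ?thesis
    unfolding radon_Linf_estimate_def Let_def e_def[symmetric] W_def[symmetric] p_def[symmetric]
  proof (intro exI allI impI)
    fix F :: "real \<Rightarrow> real"
    assume F[measurable]: "F \<in> borel_measurable borel"
    define N where "N = lorentz_norm p W (\<lambda>x. F \<bar>x \<bullet> e\<bar>)"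
    assume "lorentz_norm p W (\<lambda>x. F \<bar>x \<bullet> e\<bar>) < \<infinity>"
    then have Nfin: "N = ennreal (enn2real N)" by (simp add: N_def less_top)
    have wspace: "space W = UNIV" by (simp add: W_def weighted_sphere_def)
    have bound: "ennreal (B * ((1 - c\<^sup>2) powr (g1 / 2) * c)) * (\<integral>\<^sup>+t. ennreal \<bar>F (c * t)\<bar> \<partial>h) \<le> N"
      if c: "0 < c" "c < 1" for c
    proof -
      have Fc[measurable]: "(\<lambda>t. \<bar>F (c * t)\<bar>) \<in> borel_measurable h" by measurable
      note lc = nn_integral_layer_cake[OF hsig Fc]
      have "ennreal (B * ((1 - c\<^sup>2) powr (g1 / 2) * c)) * (\<integral>\<^sup>+t. ennreal \<bar>F (c * t)\<bar> \<partial>h) =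
         (\<integral>\<^sup>+s. ennreal (B * ((1 - c\<^sup>2) powr (g1 / 2) * c)) * (indicator {0<..} s * emeasure h {t \<in> space h. \<bar>F (c * t)\<bar> > s}) \<partial>lborel)"
        unfolding lc(1) by (rule nn_integral_cmult[symmetric]) (rule lc(2))
      also have "\<dots> \<le> (\<integral>\<^sup>+s. indicator {0<..} s * epowr (emeasure W {x \<in> space W. \<bar>F \<bar>x \<bullet> e\<bar>\<bar> > s}) (1 / p) \<partial>lborel)"
      proof (rule nn_integral_mono)
        fix s :: real
        have "{u. \<bar>F u\<bar> > s} \<in> sets borel" by measurable
        from set_le[OF c this]
        show "ennreal (B * ((1 - c\<^sup>2) powr (g1 / 2) * c)) * (indicator {0<..} s * emeasure h {t \<in> space h. \<bar>F (c * t)\<bar> > s})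
          \<le> indicator {0<..} s * epowr (emeasure W {x \<in> space W. \<bar>F \<bar>x \<bullet> e\<bar>\<bar> > s}) (1 / p)"
          by (auto simp: indicator_def wspace)
      qed
      \<comment> \<open>The factor p in the Lorentz norm exceeds 1 and is given away.\<close>
      also have "\<dots> \<le> ennreal p * \<dots>"
        using mult_right_mono[of 1 "ennreal p" "\<integral>\<^sup>+s. indicator {0<..} s * epowr (emeasure W {x \<in> space W. \<bar>F \<bar>x \<bullet> e\<bar>\<bar> > s}) (1 / p) \<partial>lborel"] p
        by (simp add: ennreal_ge_1)
      also have "\<dots> = N" by (simp add: N_def lorentz_norm_def)
      finally show ?thesis .
    qed
    \<comment> \<open>Great spheres through the origin have c = 1. There
      \<open>(1 - c\<^sup>2) powr (g1 / 2)\<close> is 0, so no finiteness of the integral could be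
      deduced.\<close>
    have "AE w in (lborel :: (real^'m^'k) measure). e \<notin> span (range (\<lambda>j. w $ j))"
      using m k kn e by (intro AE_not_in_span_rows) auto
    then show "AE w in (lborel :: (real^'m^'k) measure).
           Xi e (CARD('k) - 1) (span (range (\<lambda>j. w $ j))) \<longrightarrow>
             radon_integrable TYPE('k) (\<lambda>x. F \<bar>x \<bullet> e\<bar>) (span (range (\<lambda>j. w $ j))) \<and>
             \<bar>sin (dist_origin e (span (range (\<lambda>j. w $ j)))) powr g1 * cos (dist_origin e (span (range (\<lambda>j. w $ j)))) powr g2 * radon TYPE('k) (\<lambda>x. F \<bar>x \<bullet> e\<bar>) (span (range (\<lambda>j. w $ j)))\<bar>
               \<le> sphere_const k / B * enn2real (lorentz_norm p W (\<lambda>x. F \<bar>x \<bullet> e\<bar>))"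
    proof (eventually_elim, intro impI)
      fix w :: "real^'m^'k"
      define V where "V = span (range (\<lambda>j. w $ j))"
      assume "e \<notin> span (range (\<lambda>j. w $ j))" and "Xi e (CARD('k) - 1) (span (range (\<lambda>j. w $ j)))"
      then have eV: "e \<notin> V" and V: "subspace V" "dim V = CARD('k)" and dV: "dist_origin e V < pi / 2"
        using k by (auto simp: Xi_def V_def)
      note d = dist_origin_bounds[where 'k = 'k, OF V e]
      define c where "c = cos (dist_origin e V)"
      have c1: "c < 1" using d(2,7) eV by (auto simp: c_def less_le)
      have c0: "c > 0"
        using dV d(3) d(1) by (cases "cos (dist_origin e V) = 0") (auto simp: c_def)
      have sq: "1 - c\<^sup>2 > 0" using one_minus_square_pos[OF c0 c1] .
      have sin: "sin (dist_origin e V) = sqrt (1 - c\<^sup>2)" using d(4) by (simp add: c_def)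
      define I where "I = (\<integral>\<^sup>+t. ennreal \<bar>F (c * t)\<bar> \<partial>h)"
      define b where "b = B * ((1 - c\<^sup>2) powr (g1 / 2) * c)"
      have b: "b > 0" using B sq c0 by (simp add: b_def)
      have bI: "ennreal b * I \<le> ennreal (enn2real N)" using bound[OF c0 c1] Nfin by (simp add: b_def I_def)
      \<comment> \<open>As b is positive, the bound also makes the integral finite; this yields the
        integrability that the estimate asserts along with the inequality.\<close>
      then have "ennreal b * I \<noteq> top" by (metis ennreal_less_top leD less_top)
      then have Ifin: "I \<noteq> top" using b by (auto simp: ennreal_mult_eq_top_iff)
      define r where "r = enn2real I"
      have Ir: "I = ennreal r" using Ifin by (simp add: r_def less_top)
      have r0: "r \<ge> 0" by (simp add: r_def)
      have br: "b * r \<le> enn2real N" using bI b r0 unfolding Ir by (simp add: ennreal_mult'[symmetric])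
      have [measurable]: "(\<lambda>x. F \<bar>radon_param TYPE('k) V x \<bullet> e\<bar>) \<in> borel_measurable sphere_measure"
        by measurable
      have nn: "(\<integral>\<^sup>+x. ennreal (norm (F \<bar>radon_param TYPE('k) V x \<bullet> e\<bar>)) \<partial>sphere_measure) = ennreal (sphere_const k * r)"
      proof -
        have "(\<integral>\<^sup>+x. ennreal \<bar>F \<bar>radon_param TYPE('k) V x \<bullet> e\<bar>\<bar> \<partial>sphere_measure) = ennreal (sphere_const k) * I"
          unfolding I_def c_def h_def
          by (rule nn_integral_radon_param[of "\<lambda>t. ennreal \<bar>F t\<bar>"]) (use V e k in auto)
        then show ?thesis using sn by (simp add: Ir ennreal_mult'[symmetric])
      qed
      then have int: "integrable sphere_measure (\<lambda>x. F \<bar>radon_param TYPE('k) V x \<bullet> e\<bar>)"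
        by (intro integrableI_bounded) auto
      have rad: "\<bar>radon TYPE('k) (\<lambda>x. F \<bar>x \<bullet> e\<bar>) V\<bar> \<le> sphere_const k * r"
      proof -
        have "\<bar>radon TYPE('k) (\<lambda>x. F \<bar>x \<bullet> e\<bar>) V\<bar> \<le> (\<integral>x. norm (F \<bar>radon_param TYPE('k) V x \<bullet> e\<bar>) \<partial>sphere_measure)"
          unfolding radon_def using integral_norm_bound[of sphere_measure "\<lambda>x. F \<bar>radon_param TYPE('k) V x \<bullet> e\<bar>"] by simp
        also have "\<dots> = enn2real (\<integral>\<^sup>+x. ennreal (norm (F \<bar>radon_param TYPE('k) V x \<bullet> e\<bar>)) \<partial>sphere_measure)"
          by (rule integral_eq_nn_integral) auto
        also have "\<dots> = sphere_const k * r" using nn sn r0 by simp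
        finally show ?thesis .
      qed
      have "\<bar>sin (dist_origin e V) powr g1 * cos (dist_origin e V) powr g2 * radon TYPE('k) (\<lambda>x. F \<bar>x \<bullet> e\<bar>) V\<bar>
        = (1 - c\<^sup>2) powr (g1 / 2) * c powr g2 * \<bar>radon TYPE('k) (\<lambda>x. F \<bar>x \<bullet> e\<bar>) V\<bar>"
        using sq by (simp add: abs_mult sin c_def[symmetric] powr_half_sqrt[symmetric] powr_powr)
      \<comment> \<open>This is where g2 >= 1 enters: c lies in (0, 1), so c^g2 <= c.\<close>
      also have "\<dots> \<le> (1 - c\<^sup>2) powr (g1 / 2) * c powr 1 * (sphere_const k * r)"
        using rad c0 c1 g2 sq by (intro mult_mono powr_mono') auto
      also have "\<dots> = sphere_const k / B * (b * r)" using B c0 by (simp add: b_def)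
      also have "\<dots> \<le> sphere_const k / B * enn2real N"
        using br B sn by (intro mult_left_mono) auto
      finally show "radon_integrable TYPE('k) (\<lambda>x. F \<bar>x \<bullet> e\<bar>) (span (range (\<lambda>j. w $ j))) \<and>
             \<bar>sin (dist_origin e (span (range (\<lambda>j. w $ j)))) powr g1 * cos (dist_origin e (span (range (\<lambda>j. w $ j)))) powr g2 * radon TYPE('k) (\<lambda>x. F \<bar>x \<bullet> e\<bar>) (span (range (\<lambda>j. w $ j)))\<bar>
               \<le> sphere_const k / B * enn2real (lorentz_norm p W (\<lambda>x. F \<bar>x \<bullet> e\<bar>))"
        using int by (simp add: radon_integrable_def V_def N_def)
    qed
  qed
qed

subsection \<open>Necessity\<close>

text \<open>The hypothesis applied to the indicator of E: the Radon transform becomes a multiple of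
  the scaled height measure of E, and the Lorentz norm becomes p times the mass to the power 1/p.
  The mass enters through an upper bound y, so that crude estimates of test sets suffice.\<close>

lemma radon_Linf_estimate_test:
  fixes n k :: nat and a1 a2 g1 g2 :: real and i0 :: "'m::finite"
  assumes m: "CARD('m) = n + 1" and k: "CARD('k::finite) = k + 1" "1 \<le> k" and kn: "k < n" and a2: "a2 > 0"
    and est: "radon_Linf_estimate TYPE('k) (axis i0 1 :: real^'m) a1 a2 g1 g2"
  obtains D :: real where "D > 0"
    "\<And>E y \<alpha> \<beta>. \<lbrakk>E \<in> sets borel; emeasure (height_measure (a1 + real n) a2) E \<le> ennreal y;
        0 < \<alpha>; \<alpha> < \<beta>; \<beta> < 1\<rbrakk> \<Longrightarrow>
      \<exists>c. \<alpha> < c \<and> c < \<beta> \<and>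
        (1 - c\<^sup>2) powr (g1 / 2) * c powr g2 * measure (height_measure (real k) 0) {t. c * t \<in> E} \<le> D * y powr (1 / (1 + a2))"
proof -
  define e where "e = (axis i0 1 :: real^'m)"
  define p where "p = 1 + a2"
  define W where "W = weighted_sphere e a1 a2"
  define h where "h = height_measure (real k) 0"
  have e: "norm e = 1" by (simp add: e_def)
  have k1: "real k \<ge> 1" using k by simp
  have sn: "sphere_const n > 0" "sphere_const k > 0" using kn k by (auto intro: sphere_const_pos)
  have p: "p > 1" using a2 by (simp add: p_def)
  obtain C where C: "\<And>F. F \<in> borel_measurable borel \<Longrightarrow>
        lorentz_norm p W (\<lambda>x. F \<bar>x \<bullet> e\<bar>) < \<infinity> \<Longrightarrow>
        (AE w in (lborel :: (real^'m^'k) measure).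
           Xi e (CARD('k) - 1) (span (range (\<lambda>j. w $ j))) \<longrightarrow>
             radon_integrable TYPE('k) (\<lambda>x. F \<bar>x \<bullet> e\<bar>) (span (range (\<lambda>j. w $ j))) \<and>
             \<bar>sin (dist_origin e (span (range (\<lambda>j. w $ j)))) powr g1 * cos (dist_origin e (span (range (\<lambda>j. w $ j)))) powr g2 * radon TYPE('k) (\<lambda>x. F \<bar>x \<bullet> e\<bar>) (span (range (\<lambda>j. w $ j)))\<bar>
               \<le> C * enn2real (lorentz_norm p W (\<lambda>x. F \<bar>x \<bullet> e\<bar>)))"
    using est unfolding radon_Linf_estimate_def Let_def e_def[symmetric] W_def[symmetric] p_def[symmetric] by blast
  \<comment> \<open>\<open>C\<close> is an arbitrary real; passing to
    \<open>\<bar>C\<bar> + 1\<close> makes D positive.\<close>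
  define D where "D = (\<bar>C\<bar> + 1) * p * sphere_const n powr (1 / p) / sphere_const k"
  have D: "D > 0" using p sn by (auto simp: D_def intro!: divide_pos_pos mult_pos_pos)
  show thesis
  proof (rule that[OF D])
    fix E :: "real set" and y \<alpha> \<beta> :: real
    assume E[measurable]: "E \<in> sets borel" and y: "emeasure (height_measure (a1 + real n) a2) E \<le> ennreal y"
      and ab: "0 < \<alpha>" "\<alpha> < \<beta>" "\<beta> < 1"
    define F where "F = (indicator E :: real \<Rightarrow> real)"
    have F[measurable]: "F \<in> borel_measurable borel" by (simp add: F_def)
    define T where "T = emeasure W {x. \<bar>x \<bullet> e\<bar> \<in> E}"
    define Y where "Y = enn2real (emeasure (height_measure (a1 + real n) a2) E)"
    have Y: "emeasure (height_measure (a1 + real n) a2) E = ennreal Y" "Y \<ge> 0"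
      unfolding Y_def using le_less_trans[OF y ennreal_less_top] by (simp_all add: less_top)
    have Yy: "Y \<le> max 0 y" using y unfolding Y(1) by (cases "y \<ge> 0") (auto simp: ennreal_neg Y(2))
    have T: "T = ennreal (sphere_const n * Y)"
      unfolding T_def W_def e_def using emeasure_weighted_sphere[OF E m, of i0 a1 a2] kn Y sn
      by (simp add: ennreal_mult'[symmetric])
    have wspace: "space W = UNIV" by (simp add: W_def weighted_sphere_def)
    have level: "indicator {0<..} s * epowr (emeasure W {x \<in> space W. \<bar>F \<bar>x \<bullet> e\<bar>\<bar> > s}) (1 / p) = epowr T (1 / p) * indicator {0<..<1} s" for s :: real
    proof -
      have "{x. \<bar>F \<bar>x \<bullet> e\<bar>\<bar> > s} = {x. \<bar>x \<bullet> e\<bar> \<in> E}" if "0 < s" "s < 1"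
        using that by (auto simp: F_def indicator_def split: if_splits)
      moreover have "{x. \<bar>F \<bar>x \<bullet> e\<bar>\<bar> > s} = {}" if "1 \<le> s"
        using that by (auto simp: F_def indicator_def split: if_splits)
      ultimately show ?thesis
        by (cases "s \<le> 0"; cases "s < 1") (auto simp: wspace T_def epowr_def)
    qed
    have "lorentz_norm p W (\<lambda>x. F \<bar>x \<bullet> e\<bar>) = ennreal p * (\<integral>\<^sup>+s. epowr T (1 / p) * indicator {0<..<1} (s::real) \<partial>lborel)"
      unfolding lorentz_norm_def level ..
    also have "\<dots> = ennreal p * epowr T (1 / p)" by (simp add: nn_integral_cmult)
    also have "\<dots> = ennreal (p * (sphere_const n * Y) powr (1 / p))"
      using sn Y p by (simp add: T epowr_def ennreal_mult'[symmetric])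
    finally have norm: "lorentz_norm p W (\<lambda>x. F \<bar>x \<bullet> e\<bar>) = ennreal (p * (sphere_const n * Y) powr (1 / p))" .
    have card: "CARD('k) < CARD('m)" using m k kn by simp
    obtain w :: "real^'m^'k" where
      w: "Xi e k (span (range (\<lambda>j. w $ j)))" "\<alpha> < cos (dist_origin e (span (range (\<lambda>j. w $ j))))"
         "cos (dist_origin e (span (range (\<lambda>j. w $ j)))) < \<beta>" and
      P: "Xi e (CARD('k) - 1) (span (range (\<lambda>j. w $ j))) \<longrightarrow>
             radon_integrable TYPE('k) (\<lambda>x. F \<bar>x \<bullet> e\<bar>) (span (range (\<lambda>j. w $ j))) \<and>
             \<bar>sin (dist_origin e (span (range (\<lambda>j. w $ j)))) powr g1 * cos (dist_origin e (span (range (\<lambda>j. w $ j)))) powr g2 * radon TYPE('k) (\<lambda>x. F \<bar>x \<bullet> e\<bar>) (span (range (\<lambda>j. w $ j)))\<bar>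
               \<le> C * enn2real (lorentz_norm p W (\<lambda>x. F \<bar>x \<bullet> e\<bar>))"
      using ex_Xi_height_between[OF card k(1) ab C[OF F], of i0, folded e_def] norm by auto
    define V where "V = span (range (\<lambda>j. w $ j))"
    define c where "c = cos (dist_origin e V)"
    have V: "subspace V" "dim V = CARD('k)" using w k by (auto simp: Xi_def V_def)
    note d = dist_origin_bounds[where 'k = 'k, OF V e]
    have c: "\<alpha> < c" "c < \<beta>" using w by (auto simp: c_def V_def)
    have c01: "0 < c" "c < 1" using c ab by auto
    have sq: "1 - c\<^sup>2 > 0" using one_minus_square_pos[OF c01] .
    have sin: "sin (dist_origin e V) = sqrt (1 - c\<^sup>2)" using d(4) by (simp add: c_def)
    define \<mu> where "\<mu> = measure h {t. c * t \<in> E}"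
    have "radon TYPE('k) (\<lambda>x. F \<bar>x \<bullet> e\<bar>) V = enn2real (\<integral>\<^sup>+x. ennreal (F \<bar>radon_param TYPE('k) V x \<bullet> e\<bar>) \<partial>sphere_measure)"
      unfolding radon_def by (rule integral_eq_nn_integral) (auto simp: F_def)
    also have "(\<integral>\<^sup>+x. ennreal (F \<bar>radon_param TYPE('k) V x \<bullet> e\<bar>) \<partial>sphere_measure) = ennreal (sphere_const k) * (\<integral>\<^sup>+t. ennreal (F (c * t)) \<partial>h)"
      unfolding c_def h_def by (rule nn_integral_radon_param[of "\<lambda>t. ennreal (F t)"]) (use V e k in auto)
    also have "(\<integral>\<^sup>+t. ennreal (F (c * t)) \<partial>h) = (\<integral>\<^sup>+t. indicator {t. c * t \<in> E} t \<partial>h)"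
      by (rule nn_integral_cong) (auto simp: F_def indicator_def)
    also have "\<dots> = emeasure h {t. c * t \<in> E}"
    proof (rule nn_integral_indicator)
      have "{t. c * t \<in> E} \<in> sets borel" by measurable
      then show "{t. c * t \<in> E} \<in> sets h" by (simp add: h_def)
    qed
    also have "\<dots> = ennreal \<mu>"
      unfolding \<mu>_def h_def by (rule emeasure_eq_ennreal_measure) (metis emeasure_height_measure_finite[OF k1] less_irrefl infinity_ennreal_def)
    finally have rad: "radon TYPE('k) (\<lambda>x. F \<bar>x \<bullet> e\<bar>) V = sphere_const k * \<mu>"
      using sn by (simp add: ennreal_mult'[symmetric] \<mu>_def)
    have "\<bar>sqrt (1 - c\<^sup>2) powr g1 * c powr g2 * (sphere_const k * \<mu>)\<bar> \<le> C * (p * (sphere_const n * Y) powr (1 / p))"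
      using P w(1) k p unfolding V_def[symmetric] norm rad sin c_def[symmetric] by simp
    also have "\<dots> \<le> (\<bar>C\<bar> + 1) * (p * (sphere_const n * Y) powr (1 / p))"
      using p by (intro mult_right_mono) auto
    also have "\<dots> = sphere_const k * (D * Y powr (1 / p))"
      using sn Y by (simp add: D_def powr_mult)
    also have "\<bar>sqrt (1 - c\<^sup>2) powr g1 * c powr g2 * (sphere_const k * \<mu>)\<bar> = sphere_const k * ((1 - c\<^sup>2) powr (g1 / 2) * c powr g2 * \<mu>)"
      using sn sq by (simp add: abs_mult \<mu>_def powr_half_sqrt[symmetric] powr_powr)
    finally have "(1 - c\<^sup>2) powr (g1 / 2) * c powr g2 * \<mu> \<le> D * Y powr (1 / p)"
      using sn by simp
    also have "\<dots> \<le> D * y powr (1 / p)"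
    proof -
      have "Y powr (1 / p) \<le> (max 0 y) powr (1 / p)" using Yy Y p by (intro powr_mono2) auto
      also have "(max 0 y) powr (1 / p) \<le> y powr (1 / p)" by (auto simp: max_def)
      finally show ?thesis using D by simp
    qed
    finally show "\<exists>c. \<alpha> < c \<and> c < \<beta> \<and>
        (1 - c\<^sup>2) powr (g1 / 2) * c powr g2 * measure (height_measure (real k) 0) {t. c * t \<in> E} \<le> D * y powr (1 / (1 + a2))"
      using c by (auto simp: \<mu>_def h_def p_def)
  qed
qed

section \<open>Comparison of powers and crude bounds for test sets\<close>

text \<open>For z <= 1 replacing r by its absolute value only lowers the power. The bound thus
  covers both signs of an exponent such as g1/2 or g2, whose sign is not yet known when it is
  tested.\<close>

lemma powr_ge_abs:
  fixes z :: real
  assumes "0 < l" "l \<le> z" "z \<le> 1"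
  shows "l powr \<bar>r\<bar> \<le> z powr r"
proof -
  have "l powr \<bar>r\<bar> \<le> z powr \<bar>r\<bar>" using assms by (intro powr_mono2) auto
  also have "\<dots> \<le> z powr r" using assms by (intro powr_mono') auto
  finally show ?thesis .
qed

lemma powr_le_abs:
  fixes z :: real
  assumes "0 < l" "l \<le> z" "z \<le> 1"
  shows "z powr r \<le> l powr (- \<bar>r\<bar>)"
proof -
  have "z powr r \<le> z powr (- \<bar>r\<bar>)" using assms by (intro powr_mono') auto
  also have "\<dots> \<le> l powr (- \<bar>r\<bar>)" using assms by (intro powr_mono2') auto
  finally show ?thesis .
qed

lemma powr_ge_comparable:
  fixes x z :: real
  assumes "0 < x" "x / 2 \<le> z" "z \<le> x"
  shows "(1 / 2) powr \<bar>r\<bar> * x powr r \<le> z powr r"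
proof -
  have "(1 / 2) powr \<bar>r\<bar> \<le> (z / x) powr r" using assms by (intro powr_ge_abs) (auto simp: field_simps)
  then have "(1 / 2) powr \<bar>r\<bar> * x powr r \<le> (z / x) powr r * x powr r" by (intro mult_right_mono) auto
  also have "\<dots> = z powr r" using assms by (subst powr_mult[symmetric]) auto
  finally show ?thesis .
qed

text \<open>Each necessary condition is read off from such a comparison as x tends to 0.\<close>

lemma powr_exponent_le:
  fixes a b :: real
  assumes le: "\<And>x. 0 < x \<Longrightarrow> x < x0 \<Longrightarrow> K1 * x powr a \<le> K2 * x powr b"
    and K: "K1 > 0" "K2 > 0" and x0: "x0 > 0"
  shows "b \<le> a"
proof (rule ccontr)
  assume "\<not> ?thesis"
  then have ab: "a < b" by simp
  \<comment> \<open>At this point K2 x^b is at most half of K1 x^a.\<close>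
  define x where "x = min (x0 / 2) ((K1 / (2 * K2)) powr (1 / (b - a)))"
  have x: "0 < x" "x < x0" using K x0 by (auto simp: x_def)
  have "x powr (b - a) \<le> ((K1 / (2 * K2)) powr (1 / (b - a))) powr (b - a)"
    using x ab by (intro powr_mono2) (auto simp: x_def)
  also have "\<dots> = K1 / (2 * K2)" using ab K by (simp add: powr_powr)
  finally have s: "x powr (b - a) \<le> K1 / (2 * K2)" .
  have "K1 * x powr a \<le> K2 * x powr b" by (rule le[OF x])
  also have "x powr b = x powr (b - a) * x powr a" by (simp add: powr_add[symmetric])
  also have "K2 * (x powr (b - a) * x powr a) \<le> K2 * (K1 / (2 * K2) * x powr a)"
    using s K by (intro mult_left_mono mult_right_mono) auto
  also have "\<dots> = K1 * x powr a / 2" using K by simp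
  finally show False using K x by simp
qed

lemma emeasure_height_measure_le:
  assumes [measurable]: "E \<in> sets borel" and lu: "l \<le> u" and B: "B \<ge> 0"
    and E: "\<And>t. t \<in> E \<Longrightarrow> 0 < t \<Longrightarrow> t < 1 \<Longrightarrow> l \<le> t \<and> t \<le> u \<and> (1 - t\<^sup>2) powr (A / 2 - 1) * t powr q \<le> B"
  shows "emeasure (height_measure A q) E \<le> ennreal (B * (u - l))"
proof -
  have "emeasure (height_measure A q) E \<le> (\<integral>\<^sup>+t. ennreal B * indicator {l..u} t \<partial>lborel)"
    unfolding emeasure_height_measure[OF assms(1)]
    by (intro nn_integral_mono) (use E in \<open>auto simp: indicator_def intro!: ennreal_leI\<close>)
  also have "\<dots> = ennreal (B * (u - l))"
    using lu B by (simp add: nn_integral_cmult ennreal_mult'[symmetric])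
  finally show ?thesis .
qed

lemma measure_height_measure_ge:
  assumes k: "k \<ge> 1" and E[measurable]: "E \<in> sets borel" and lu: "0 \<le> l" "l \<le> u" "u \<le> 1" and B: "B \<ge> 0"
    and sub: "\<And>t. l < t \<Longrightarrow> t < u \<Longrightarrow> t \<in> E \<and> B \<le> (1 - t\<^sup>2) powr (k / 2 - 1)"
  shows "B * (u - l) \<le> measure (height_measure k 0) E"
proof -
  have "ennreal (B * (u - l)) = (\<integral>\<^sup>+t. ennreal B * indicator {l<..<u} t \<partial>lborel)"
    using lu B by (simp add: nn_integral_cmult ennreal_mult'[symmetric])
  also have "\<dots> \<le> emeasure (height_measure k 0) E"
    unfolding emeasure_height_measure[OF E]
    by (intro nn_integral_mono) (use sub lu in \<open>auto simp: indicator_def intro!: ennreal_leI\<close>)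
  also have "\<dots> = ennreal (measure (height_measure k 0) E)"
    by (rule emeasure_eq_ennreal_measure) (metis emeasure_height_measure_finite[OF k] less_irrefl infinity_ennreal_def)
  finally show ?thesis using lu B by (simp add: measure_nonneg)
qed

lemma radon_Linf_estimate_necessary:
  fixes n k :: nat and a1 a2 g1 g2 :: real and i0 :: "'m::finite"
  assumes m: "CARD('m) = n + 1" and k: "CARD('k::finite) = k + 1" "1 \<le> k" and kn: "k < n" and a2: "a2 > 0"
    and est: "radon_Linf_estimate TYPE('k) (axis i0 1 :: real^'m) a1 a2 g1 g2"
  shows "g2 \<ge> 1" "g1 \<ge> 0" "k = 1 \<Longrightarrow> 1 + a2 \<ge> 2" "g1 \<ge> (a1 + real n) / (1 + a2) - real k"
proof -
  define p where "p = 1 + a2"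
  define A where "A = a1 + real n"
  define h where "h = height_measure (real k) 0"
  define J where "J = (1 / 4 :: real) powr (- \<bar>A / 2 - 1\<bar>)"
  have J: "J > 0" by (simp add: J_def)
  have k1: "real k \<ge> 1" using k by simp
  have p: "p > 1" using a2 by (simp add: p_def)
  obtain D where D: "D > 0" and test: "\<And>E y \<alpha> \<beta>. \<lbrakk>E \<in> sets borel; emeasure (height_measure A a2) E \<le> ennreal y;
        0 < \<alpha>; \<alpha> < \<beta>; \<beta> < 1\<rbrakk> \<Longrightarrow>
      \<exists>c. \<alpha> < c \<and> c < \<beta> \<and> (1 - c\<^sup>2) powr (g1 / 2) * c powr g2 * measure h {t. c * t \<in> E} \<le> D * y powr (1 / p)"
    using radon_Linf_estimate_test[OF m k kn a2 est] unfolding p_def A_def h_def by metis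
  have meas: "{t. c * t \<in> E} \<in> sets borel" if [measurable]: "E \<in> sets borel" for c and E :: "real set"
    by measurable
  have quarter: "1 / 4 \<le> 1 - t\<^sup>2" if "0 < t" "t \<le> 3 / 4" for t :: real
  proof -
    have "t\<^sup>2 \<le> (3 / 4)\<^sup>2" using that by (intro power_mono) auto
    then show ?thesis by (simp add: power2_eq_square)
  qed
  define H where "H = (1 / 4 :: real) powr \<bar>real k / 2 - 1\<bar> * (1 / 2 - 0)"
  have H: "H > 0" by (simp add: H_def)
  have H_le: "H \<le> measure h E" if "E \<in> sets borel" "{0<..<1/2} \<subseteq> E" for E
    unfolding H_def h_def
  proof (rule measure_height_measure_ge[OF k1 that(1)])
    fix t :: real assume t: "0 < t" "t < 1 / 2"
    have "1 / 4 \<le> 1 - t\<^sup>2" using t by (intro quarter) auto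
    then show "t \<in> E \<and> (1 / 4) powr \<bar>real k / 2 - 1\<bar> \<le> (1 - t\<^sup>2) powr (real k / 2 - 1)"
      using that t by (auto intro: powr_ge_abs)
  qed auto

  \<comment> \<open>Test set (0, x) with c between x/2 and x: scaling by c sends (0, 1/2) into the
    set, so the left side is of order x^g2. The mass is of order x^p, so the right side is of order
    x.\<close>
  show "g2 \<ge> 1"
  proof (rule powr_exponent_le[of "1 / 2"])
    fix x :: real assume x: "0 < x" "x < 1 / 2"
    have "emeasure (height_measure A a2) {0<..<x} \<le> ennreal (J * x powr a2 * (x - 0))"
    proof (rule emeasure_height_measure_le)
      fix t assume t: "t \<in> {0<..<x}"
      have "1 / 4 \<le> 1 - t\<^sup>2" using t x by (intro quarter) auto
      then have "(1 - t\<^sup>2) powr (A / 2 - 1) \<le> J" unfolding J_def using t by (intro powr_le_abs) auto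
      moreover have "t powr a2 \<le> x powr a2" using t a2 by (intro powr_mono2) auto
      ultimately show "0 \<le> t \<and> t \<le> x \<and> (1 - t\<^sup>2) powr (A / 2 - 1) * t powr a2 \<le> J * x powr a2"
        using t J by (auto intro!: mult_mono)
    qed (use x J in auto)
    also have "J * x powr a2 * (x - 0) = J * x powr p"
      using x by (simp add: p_def powr_add)
    finally obtain c where c: "x / 2 < c" "c < x" and
      le: "(1 - c\<^sup>2) powr (g1 / 2) * c powr g2 * measure h {t. c * t \<in> {0<..<x}} \<le> D * (J * x powr p) powr (1 / p)"
      using test[of "{0<..<x}" "J * x powr p" "x / 2" x] x by auto
    have q: "1 / 4 \<le> 1 - c\<^sup>2" using c x by (intro quarter) auto
    have "c * t < x" if "0 < t" "t < 1 / 2" for t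
      using mult_strict_mono[of c x t 1] that c x by auto
    then have hm: "H \<le> measure h {t. c * t \<in> {0<..<x}}"
      using c x by (intro H_le meas) auto
    have "(1 / 4) powr \<bar>g1 / 2\<bar> * ((1 / 2) powr \<bar>g2\<bar> * x powr g2) * H \<le>
       (1 - c\<^sup>2) powr (g1 / 2) * c powr g2 * measure h {t. c * t \<in> {0<..<x}}"
      using q c x H hm by (intro mult_mono powr_ge_abs powr_ge_comparable) auto
    also note le
    also have "D * (J * x powr p) powr (1 / p) = D * J powr (1 / p) * x powr 1"
      using x p J by (simp add: powr_mult powr_powr)
    finally show "(1 / 4) powr \<bar>g1 / 2\<bar> * (1 / 2) powr \<bar>g2\<bar> * H * x powr g2 \<le> D * J powr (1 / p) * x powr 1"
      by (simp add: mult_ac)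
  qed (use D J H in auto)

  \<comment> \<open>The interval for c in the tests with c near 1 is chosen so that 1 - c^2 is
    comparable to x.\<close>
  have sqrt_props: "1 / 2 \<le> c \<and> c < 1 \<and> x / 2 < 1 - c\<^sup>2 \<and> 1 - c\<^sup>2 < x"
    if "sqrt (1 - x) < c" "c < sqrt (1 - x / 2)" "0 < x" "x < 1 / 4" for c x
  proof -
    have c0: "c > 0" using that(1) order_le_less_trans[of 0 "sqrt (1 - x)" c] that by simp
    have "(sqrt (1 - x))\<^sup>2 < c\<^sup>2" using that by (intro power_strict_mono) auto
    moreover have "c\<^sup>2 < (sqrt (1 - x / 2))\<^sup>2" using that c0 by (intro power_strict_mono) auto
    ultimately have b: "1 - x < c\<^sup>2" "c\<^sup>2 < 1 - x / 2" using that by auto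
    then have "(1 / 2)\<^sup>2 \<le> c\<^sup>2" "c\<^sup>2 < 1\<^sup>2" using that by (auto simp: power2_eq_square)
    then have "1 / 2 \<le> c" "c < 1" using c0 by (auto intro: power2_le_imp_le power2_less_imp_less)
    then show ?thesis using b by auto
  qed

  \<comment> \<open>The set (0, 1/2) stays fixed while c tends to 1: the right side is constant and
    the left side is of order x^(g1/2).\<close>
  show g1: "g1 \<ge> 0"
  proof -
    have "0 \<le> g1 / 2"
    proof (rule powr_exponent_le[of "1 / 4"])
      fix x :: real assume x: "0 < x" "x < 1 / 4"
      have y: "emeasure (height_measure A a2) {0<..<1/2} \<le> ennreal (J * (1 / 2 - 0))"
      proof (rule emeasure_height_measure_le)
        fix t :: real assume t: "t \<in> {0<..<1/2}"
        have "1 / 4 \<le> 1 - t\<^sup>2" using t x by (intro quarter) auto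
        then have "(1 - t\<^sup>2) powr (A / 2 - 1) \<le> J" unfolding J_def using t by (intro powr_le_abs) auto
        moreover have "t powr a2 \<le> 1" using t a2 by (intro powr_le1) auto
        ultimately have "(1 - t\<^sup>2) powr (A / 2 - 1) * t powr a2 \<le> J * 1"
          using t J by (intro mult_mono) auto
        then show "0 \<le> t \<and> t \<le> 1/2 \<and> (1 - t\<^sup>2) powr (A / 2 - 1) * t powr a2 \<le> J"
          using t by auto
      qed (use J in auto)
      obtain c where c: "sqrt (1 - x) < c" "c < sqrt (1 - x / 2)" and
        le: "(1 - c\<^sup>2) powr (g1 / 2) * c powr g2 * measure h {t. c * t \<in> {0<..<1/2}} \<le> D * (J * (1 / 2 - 0)) powr (1 / p)"
        using test[OF _ y, of "sqrt (1 - x)" "sqrt (1 - x / 2)"] x by auto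
      note c' = sqrt_props[OF c x]
      have "c * t < 1 / 2" if "0 < t" "t < 1 / 2" for t
        using mult_strict_mono[of c 1 t "1 / 2"] that c' by auto
      then have hm: "H \<le> measure h {t. c * t \<in> {0<..<1/2}}"
        using c' by (intro H_le meas) auto
      have "((1 / 2) powr \<bar>g1 / 2\<bar> * x powr (g1 / 2)) * (1 / 2) powr \<bar>g2\<bar> * H \<le>
         (1 - c\<^sup>2) powr (g1 / 2) * c powr g2 * measure h {t. c * t \<in> {0<..<1/2}}"
        using c' x H hm by (intro mult_mono powr_ge_abs powr_ge_comparable) auto
      also note le
      finally show "(1 / 2) powr \<bar>g1 / 2\<bar> * (1 / 2) powr \<bar>g2\<bar> * H * x powr (g1 / 2) \<le> D * (J * (1 / 2 - 0)) powr (1 / p) * x powr 0"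
        using x by (simp add: mult_ac)
    qed (use D J H in auto)
    then show ?thesis by simp
  qed

  \<comment> \<open>For k = 1 the height density (1 - t^2)^(-1/2) blows up at t = 1. A c just above
    1/2 carries (1 - x, 1) into an interval of radius x about 1/2, where nu has bounded density. So
    x^(1/2) is compared with x^(1/p).\<close>
  show kp: "1 + a2 \<ge> 2" if "k = 1"
  proof -
    define B where "B = J * (1 / 4) powr (- \<bar>a2\<bar>)"
    have B: "B > 0" using J by (simp add: B_def)
    have "1 / p \<le> 1 / 2"
    proof (rule powr_exponent_le[of "1 / 8"])
      fix x :: real assume x: "0 < x" "x < 1 / 8"
      define E where "E = {1 / 2 - x<..<1 / 2 + x}"
      have y: "emeasure (height_measure A a2) E \<le> ennreal (B * ((1 / 2 + x) - (1 / 2 - x)))"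
      proof (rule emeasure_height_measure_le)
        fix t :: real assume t: "t \<in> E"
        have "1 / 4 \<le> 1 - t\<^sup>2" using t x by (intro quarter) (auto simp: E_def)
        then have "(1 - t\<^sup>2) powr (A / 2 - 1) \<le> J" unfolding J_def by (intro powr_le_abs) auto
        moreover have "t powr a2 \<le> (1 / 4) powr (- \<bar>a2\<bar>)" using t x by (intro powr_le_abs) (auto simp: E_def)
        ultimately show "1 / 2 - x \<le> t \<and> t \<le> 1 / 2 + x \<and> (1 - t\<^sup>2) powr (A / 2 - 1) * t powr a2 \<le> B"
          using t J unfolding B_def E_def by (auto intro!: mult_mono)
      qed (use B x in \<open>auto simp: E_def\<close>)
      obtain c where c: "1 / 2 < c" "c < 1 / 2 + x / 2" and
        le: "(1 - c\<^sup>2) powr (g1 / 2) * c powr g2 * measure h {t. c * t \<in> E} \<le> D * (B * ((1 / 2 + x) - (1 / 2 - x))) powr (1 / p)"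
        using test[OF _ y, of "1 / 2" "1 / 2 + x / 2"] x by (auto simp: E_def)
      have q: "1 / 4 \<le> 1 - c\<^sup>2" using c x by (intro quarter) auto
      have hm: "(2 * x) powr (- 1 / 2) * (1 - (1 - x)) \<le> measure h {t. c * t \<in> E}"
        unfolding h_def
      proof (rule measure_height_measure_ge[OF k1 meas])
        fix t :: real assume t: "1 - x < t" "t < 1"
        have "c * t < c" "c * (1 - x) < c * t" using c t by auto
        moreover have "c * x < x" using c x by simp
        moreover have "c * (1 - x) = c - c * x" by (simp add: algebra_simps)
        ultimately have "1 / 2 - x < c * t" "c * t < 1 / 2 + x" using c x by linarith+
        then have "c * t \<in> E" by (simp add: E_def)
        moreover have "(2 * x) powr (- 1 / 2) \<le> (1 - t\<^sup>2) powr (- 1 / 2)"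
        proof (rule powr_mono2')
          show "0 < 1 - t\<^sup>2" using t x by (intro one_minus_square_pos) auto
          have "(1 - t) * (1 + t) \<le> x * 2" using t x by (intro mult_mono) auto
          then show "1 - t\<^sup>2 \<le> 2 * x" by (simp add: algebra_simps power2_eq_square)
        qed auto
        ultimately show "t \<in> {t. c * t \<in> E} \<and> (2 * x) powr (- 1 / 2) \<le> (1 - t\<^sup>2) powr (real k / 2 - 1)"
          using \<open>k = 1\<close> by simp
      qed (use x in \<open>auto simp: E_def\<close>)
      have "(1 / 4) powr \<bar>g1 / 2\<bar> * (1 / 2) powr \<bar>g2\<bar> * ((2 * x) powr (- 1 / 2) * (1 - (1 - x))) \<le>
         (1 - c\<^sup>2) powr (g1 / 2) * c powr g2 * measure h {t. c * t \<in> E}"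
        using q c x hm by (intro mult_mono powr_ge_abs) auto
      also note le
      also have "(2 * x) powr (- 1 / 2) * (1 - (1 - x)) = 2 powr (- 1 / 2) * x powr (1 / 2)"
      proof -
        have "x powr (- 1 / 2) * x powr 1 = x powr (1 / 2)" by (subst powr_add[symmetric]) simp
        then show ?thesis using x by (simp add: powr_mult)
      qed
      also have "D * (B * ((1 / 2 + x) - (1 / 2 - x))) powr (1 / p) = D * (2 * B) powr (1 / p) * x powr (1 / p)"
        using x B by (simp add: powr_mult)
      finally show "(1 / 4) powr \<bar>g1 / 2\<bar> * (1 / 2) powr \<bar>g2\<bar> * 2 powr (- 1 / 2) * x powr (1 / 2) \<le> D * (2 * B) powr (1 / p) * x powr (1 / p)"
        by (simp add: mult_ac)
    qed (use D B in auto)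
    then show ?thesis using p by (simp add: p_def field_simps)
  qed

  \<comment> \<open>If A <= p k, the bound follows from g1 >= 0. Otherwise A > p k >= 2 by the
    conditions already proved, so the density of nu stays bounded near 1. The test set is then a
    neighbourhood of 1 of length of order x, again with 1 - c^2 of order x: x^(g1/2 + k/2) is
    compared with x^(A/(2 p)).\<close>
  show "g1 \<ge> (a1 + real n) / (1 + a2) - real k"
  proof (cases "A \<le> p * real k")
    case True
    then have "A / p \<le> real k" using p by (simp add: field_simps)
    then show ?thesis using g1 by (simp add: A_def p_def)
  next
    case False
    have "2 \<le> p * real k"
    proof (cases "k = 1")
      case True
      then show ?thesis using kp by (simp add: p_def)
    next
      case False
      then have "1 * 2 \<le> p * real k" using p k by (intro mult_mono) auto
      then show ?thesis by simp
    qed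
    then have A2: "A / 2 - 1 \<ge> 0" using False by simp
    have "A / (2 * p) \<le> g1 / 2 + real k / 2"
    proof (rule powr_exponent_le[of "1 / 4"])
      fix x :: real assume x: "0 < x" "x < 1 / 4"
      define E where "E = {sqrt (1 - 2 * x)<..<1}"
      have s1: "1 - 2 * x \<le> sqrt (1 - 2 * x)"
        using x by (intro real_le_rsqrt) (auto simp: power2_eq_square algebra_simps)
      have "emeasure (height_measure A a2) E \<le> ennreal ((2 * x) powr (A / 2 - 1) * (1 - (1 - 2 * x)))"
      proof (rule emeasure_height_measure_le)
        fix t :: real assume t: "t \<in> E" "0 < t" "t < 1"
        have "(sqrt (1 - 2 * x))\<^sup>2 \<le> t\<^sup>2" using t x by (intro power_mono) (auto simp: E_def)
        then have "1 - t\<^sup>2 \<le> 2 * x" using x by simp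
        then have "(1 - t\<^sup>2) powr (A / 2 - 1) \<le> (2 * x) powr (A / 2 - 1)"
          using A2 one_minus_square_pos[of t] t by (intro powr_mono2) auto
        moreover have "t powr a2 \<le> 1" using t a2 by (intro powr_le1) auto
        ultimately have "(1 - t\<^sup>2) powr (A / 2 - 1) * t powr a2 \<le> (2 * x) powr (A / 2 - 1) * 1"
          by (intro mult_mono) auto
        then show "1 - 2 * x \<le> t \<and> t \<le> 1 \<and> (1 - t\<^sup>2) powr (A / 2 - 1) * t powr a2 \<le> (2 * x) powr (A / 2 - 1)"
          using t s1 by (auto simp: E_def)
      qed (use x in \<open>auto simp: E_def\<close>)
      also have "(2 * x) powr (A / 2 - 1) * (1 - (1 - 2 * x)) = (2 * x) powr (A / 2)"
        using x by (simp add: powr_diff)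
      finally have y: "emeasure (height_measure A a2) E \<le> ennreal ((2 * x) powr (A / 2))" .
      obtain c where c: "sqrt (1 - x) < c" "c < sqrt (1 - x / 2)" and
        le: "(1 - c\<^sup>2) powr (g1 / 2) * c powr g2 * measure h {t. c * t \<in> E} \<le> D * ((2 * x) powr (A / 2)) powr (1 / p)"
        using test[OF _ y, of "sqrt (1 - x)" "sqrt (1 - x / 2)"] x by (auto simp: E_def)
      note c' = sqrt_props[OF c x]
      define b where "b = (1 / 2) powr \<bar>real k / 2 - 1\<bar> * x powr (real k / 2 - 1)"
      have "b * (sqrt (1 - x / 2) - sqrt (1 - x)) \<le> measure h {t. c * t \<in> E}"
        unfolding h_def
      proof (rule measure_height_measure_ge[OF k1 meas])
        fix t :: real assume t: "sqrt (1 - x) < t" "t < sqrt (1 - x / 2)"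
        note t' = sqrt_props[OF t x]
        \<comment> \<open>With c and t both above sqrt (1 - x), the product exceeds 1 - x, which is
          at least sqrt (1 - 2 x); this explains the 2 in \<open>E\<close>.\<close>
        have "sqrt (1 - x) * sqrt (1 - x) < c * t"
          using c t x c' by (intro mult_strict_mono) auto
        then have "1 - x < c * t" using x by simp
        moreover have "sqrt (1 - 2 * x) \<le> 1 - x"
          using x by (intro real_le_lsqrt) (auto simp: power2_eq_square algebra_simps)
        moreover have "c * t < 1" using mult_strict_mono[of c 1 t 1] c' t' by simp
        ultimately have "c * t \<in> E" by (simp add: E_def)
        moreover have "b \<le> (1 - t\<^sup>2) powr (real k / 2 - 1)"
          unfolding b_def using t' x by (intro powr_ge_comparable) auto
        ultimately show "t \<in> {t. c * t \<in> E} \<and> b \<le> (1 - t\<^sup>2) powr (real k / 2 - 1)" by simp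
      qed (use x in \<open>auto simp: E_def b_def\<close>)
      moreover have "b * (x / 4) \<le> b * (sqrt (1 - x / 2) - sqrt (1 - x))"
      proof (intro mult_left_mono)
        \<comment> \<open>The difference of the roots is (x/2)/(u + v) with u + v <= 2.\<close>
        define u v where "u = sqrt (1 - x / 2)" and "v = sqrt (1 - x)"
        have "u\<^sup>2 - v\<^sup>2 = x / 2" using x by (simp add: u_def v_def)
        then have "(u - v) * (u + v) = x / 2" by (simp add: power2_eq_square algebra_simps)
        moreover have "u \<le> 1" "v \<le> 1" "v \<le> u" using x by (auto simp: u_def v_def)
        then have "(u - v) * (u + v) \<le> (u - v) * 2" by (intro mult_left_mono) auto
        ultimately show "x / 4 \<le> sqrt (1 - x / 2) - sqrt (1 - x)" by (simp add: u_def v_def)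
      qed (simp add: b_def)
      ultimately have hm: "b * (x / 4) \<le> measure h {t. c * t \<in> E}" by linarith
      have "((1 / 2) powr \<bar>g1 / 2\<bar> * x powr (g1 / 2)) * (1 / 2) powr \<bar>g2\<bar> * (b * (x / 4)) \<le>
         (1 - c\<^sup>2) powr (g1 / 2) * c powr g2 * measure h {t. c * t \<in> E}"
        using c' x hm by (intro mult_mono powr_ge_abs powr_ge_comparable) (auto simp: b_def)
      also note le
      also have "D * ((2 * x) powr (A / 2)) powr (1 / p) = D * 2 powr (A / (2 * p)) * x powr (A / (2 * p))"
        using x by (simp add: powr_powr powr_mult)
      finally have "((1 / 2) powr \<bar>g1 / 2\<bar> * (1 / 2) powr \<bar>g2\<bar> * (1 / 2) powr \<bar>real k / 2 - 1\<bar> / 4) *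
          (x powr (g1 / 2) * (x powr (real k / 2 - 1) * x)) \<le> D * 2 powr (A / (2 * p)) * x powr (A / (2 * p))"
        by (simp add: b_def mult_ac)
      also have "x powr (real k / 2 - 1) * x = x powr (real k / 2)" using x by (simp add: powr_diff)
      also have "x powr (g1 / 2) * x powr (real k / 2) = x powr (g1 / 2 + real k / 2)" by (simp add: powr_add)
      finally show "((1 / 2) powr \<bar>g1 / 2\<bar> * (1 / 2) powr \<bar>g2\<bar> * (1 / 2) powr \<bar>real k / 2 - 1\<bar> / 4) *
          x powr (g1 / 2 + real k / 2) \<le> D * 2 powr (A / (2 * p)) * x powr (A / (2 * p))" .
    qed (use D in auto)
    then have "A / p \<le> g1 + real k" using p by (simp add: field_simps)
    then show ?thesis by (simp add: A_def p_def)
  qed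
qed

theorem theorem5p11:
  fixes n k :: nat and a1 a2 g1 g2 :: real and i0 :: "'m::finite"
  assumes "CARD('m) = n + 1" and "CARD('k::finite) = k + 1"
    and "n \<ge> 2" and "1 \<le> k" and "k \<le> n - 1" and "a2 > 0"
  shows "radon_Linf_estimate TYPE('k) (axis i0 1 :: real^'m) a1 a2 g1 g2 \<longleftrightarrow>
     (g1 \<ge> max 0 ((a1 + real n) / (1 + a2) - real k) \<and> g2 \<ge> 1 \<and>
      (k = 1 \<longrightarrow> 1 + a2 \<ge> 2))"
proof
  have kn: "k < n" using assms by linarith
  note nec = radon_Linf_estimate_necessary[OF assms(1,2,4) kn assms(6)]
  assume "radon_Linf_estimate TYPE('k) (axis i0 1 :: real^'m) a1 a2 g1 g2"
  from nec[OF this] show "g1 \<ge> max 0 ((a1 + real n) / (1 + a2) - real k) \<and> g2 \<ge> 1 \<and> (k = 1 \<longrightarrow> 1 + a2 \<ge> 2)"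
    by auto
next
  assume c: "g1 \<ge> max 0 ((a1 + real n) / (1 + a2) - real k) \<and> g2 \<ge> 1 \<and> (k = 1 \<longrightarrow> 1 + a2 \<ge> 2)"
  have kn: "k < n" using assms by linarith
  \<comment> \<open>The one condition k p >= 2 covers both parts: it follows from p > 1 for k >= 2
    and is the hypothesis p >= 2 for k = 1.\<close>
  have "real k * (1 + a2) \<ge> 2"
  proof (cases "k = 1")
    case False
    then have "2 * 1 \<le> real k * (1 + a2)" using assms by (intro mult_mono) auto
    then show ?thesis by simp
  qed (use c in simp)
  then show "radon_Linf_estimate TYPE('k) (axis i0 1 :: real^'m) a1 a2 g1 g2"
    using c by (intro radon_Linf_estimate_sufficient[OF assms(1,2,4) kn assms(6)]) auto
qed

end
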